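(* For every real $r$ with $\frac{7}{4} \leq r < 2$ there exists a convex pentagon $K \subseteq \mathbb{R}^2$ satisfying $d_{BM}(K, L)=\operatorname{as}(K)=r$ for every symmetric convex body $L \subseteq \mathbb{R}^2$. If $\frac{7}{4} < r < 2$, then there are continuum many pairwise affinely non-equivalent convex pentagons $K$ with this property. Moreover, if a convex body $K \subseteq \mathbb{R}^2$ has the property that $d_{BM}(K, L)=\operatorname{as}(K)=r$ for every symmetric convex body $L \subseteq \mathbb{R}^2$, for some real $r$, then $r \geq \sqrt{\frac{3}{2}}$ and $K$ is not smooth and not strictly convex.
   Context: A convex body in $\mathbb{R}^n$ is a compact convex set with non-empty interior; it is called symmetric (centrally-symmetric) if it has a center of symmetry. For convex bodies $K, L \subseteq \mathbb{R}^n$ the Banach-Mazur distance is $$d_{BM}(K,L) = \inf \{r >0 : K+ u \subseteq T(L+v) \subseteq r(K+u) \},$$ where the infimum is taken over all invertible linear operators $T : \mathbb{R}^n \to \mathbb{R}^n$ and vectors $u, v \in \mathbb{R}^n$. For a convex body $K \subseteq \mathbb{R}^2$ the asymmetry constant is $$\operatorname{as}(K) = \inf \{ r>0 : \text{ there exists } z \in \operatorname{int} K \text{ such that } K-z \subseteq -r(K-z) \}.$$ Two convex bodies are affinely equivalent if one is the image of the other under an invertible affine map. A planar convex body is smooth if it has exactly one supporting line at each of its boundary points, and strictly convex if its boundary contains no non-degenerate segment. *)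

theory Defs
  imports "HOL-Analysis.Analysis" "HOL-Library.Equipollence"
begin

definition convex_body :: "(real^'n) set \<Rightarrow> bool" where
  "convex_body K \<longleftrightarrow> compact K \<and> convex K \<and> interior K \<noteq> {}"

definition centrally_symmetric :: "(real^'n) set \<Rightarrow> bool" where
  "centrally_symmetric K \<longleftrightarrow> (\<exists>c. (\<lambda>x. 2 *\<^sub>R c - x) ` K = K)"

(* The infima below are taken in the reals; for convex bodies the sets are non-empty and
   bounded below by 0. *)
definition banach_mazur :: "(real^'n) set \<Rightarrow> (real^'n) set \<Rightarrow> real" where
  "banach_mazur K L = Inf {r. r > 0 \<and> (\<exists>T u v. linear T \<and> bij T \<and>
     (\<lambda>x. x + u) ` K \<subseteq> T ` (\<lambda>x. x + v) ` L \<and>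
     T ` (\<lambda>x. x + v) ` L \<subseteq> (\<lambda>x. r *\<^sub>R x) ` (\<lambda>x. x + u) ` K)}"

definition asymmetry :: "(real^'n) set \<Rightarrow> real" where
  "asymmetry K = Inf {r. r > 0 \<and> (\<exists>z \<in> interior K.
     (\<lambda>x. x - z) ` K \<subseteq> (\<lambda>x. (- r) *\<^sub>R x) ` (\<lambda>x. x - z) ` K)}"

definition affinely_equivalent :: "(real^'n) set \<Rightarrow> (real^'n) set \<Rightarrow> bool" where
  "affinely_equivalent K L \<longleftrightarrow> (\<exists>T c. linear T \<and> bij T \<and> L = (\<lambda>x. T x + c) ` K)"

definition convex_pentagon :: "(real^2) set \<Rightarrow> bool" where
  "convex_pentagon K \<longleftrightarrow>
     polytope K \<and> interior K \<noteq> {} \<and> card {v. v extreme_point_of K} = 5"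

definition supporting_line_at :: "(real^2) set \<Rightarrow> real^2 \<Rightarrow> (real^2) set \<Rightarrow> bool" where
  "supporting_line_at K x H \<longleftrightarrow> (\<exists>a b. a \<noteq> 0 \<and> H = {y. a \<bullet> y = b} \<and>
     x \<in> H \<and> K \<subseteq> {y. a \<bullet> y \<le> b})"

definition smooth_body :: "(real^2) set \<Rightarrow> bool" where
  "smooth_body K \<longleftrightarrow> (\<forall>x \<in> frontier K. \<exists>!H. supporting_line_at K x H)"

definition strictly_convex_body :: "(real^2) set \<Rightarrow> bool" where
  "strictly_convex_body K \<longleftrightarrow> \<not> (\<exists>a b. a \<noteq> b \<and> closed_segment a b \<subseteq> frontier K)"

definition equidistant_to_symmetric :: "(real^2) set \<Rightarrow> real \<Rightarrow> bool" where
  "equidistant_to_symmetric K r \<longleftrightarrow> asymmetry K = r \<and>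
     (\<forall>L. convex_body L \<and> centrally_symmetric L \<longrightarrow> banach_mazur K L = r)"

end

theory Submission imports Defs
begin

text \<open>
  \<^bold>\<open>Reformulation.\<close> Write r for the asymmetry of K. A symmetric body L always lies at distance at
  least r from K, because a sandwich of L between two homothets of K, together with its own
  reflection in the centre of L, places K inside a reflected copy of itself
  (\<open>sandwich_factor_reflects\<close>). So K is equidistant as soon as every L has an affine image
  caught between K and a translate of r K.

  \<^bold>\<open>Pentagons.\<close> A symmetric L contains a triangle of largest area; send it to the standard
  triangle with vertices 0, (1,0), (0,1). Maximality confines the image of L to the triangle
  x \<le> 1, y \<le> 1, x + y \<ge> 0, and the vertices can be numbered so that the barycentric coordinate of
  the centre of L at the vertex 0 is the smallest of the three (\<open>triangle_position\<close>). With s = 2/r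
  the pentagon with vertices 0, (1,0), (s-t,t), (t,s-t), (0,1) then lies in that image, while the
  image lies in (1,1) - r K, provided that 2(s-1) \<le> t \<le> s/4 (\<open>pentagon_sandwich\<close>). This
  interval for t is non-empty if r \<ge> 7/4 and non-degenerate if r > 7/4. For fixed r the pentagons are
  pairwise affinely inequivalent: the largest triangle on the vertices has twice the area 1
  and the smallest non-degenerate one (s-2t)(s-1), which determines t
  (\<open>affinely_equivalent_pentagons\<close>).

  \<^bold>\<open>Necessary conditions.\<close> If K is at distance r from both a square and a regular hexagon, then
  these two are at distance at most r squared from one another; but their distance is at least 3/2
  (\<open>square_hexagon_factor\<close>). For the remaining claim take L to be a square. By compactness there is an
  optimal parallelogram between K and the reflected copy M = c - r K. If K is smooth, it contains no
  vertex of the parallelogram, so it can touch the boundary of M only inside edges, and never at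
  opposite edges since r > 1. If K is strictly convex, it can touch the boundary of M only at
  a single vertex of the parallelogram or at two opposite ones. In either case a translation
  moves K into the interior of M, so a smaller ratio than r would do, contradicting
  r = as(K).
\<close>

section \<open>Sandwiches and reflections\<close>

text \<open>
  Being a \<open>sandwich_factor\<close> is the property whose infimum defines the Banach-Mazur distance;
  \<open>reflects_into\<close> plays this role for the asymmetry. It writes K \<subseteq> w - r K pointwise, so that
  translates and reflections of K become equations between points.
\<close>
definition sandwich_factor :: "(real^'n) set \<Rightarrow> (real^'n) set \<Rightarrow> real \<Rightarrow> bool" where
  "sandwich_factor K L r \<longleftrightarrow> r > 0 \<and> (\<exists>T u v. linear T \<and> bij T \<and>
     (\<lambda>x. x + u) ` K \<subseteq> T ` (\<lambda>x. x + v) ` L \<and>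
     T ` (\<lambda>x. x + v) ` L \<subseteq> (\<lambda>x. r *\<^sub>R x) ` (\<lambda>x. x + u) ` K)"

definition reflects_into :: "(real^'n) set \<Rightarrow> real \<Rightarrow> (real^'n) \<Rightarrow> bool" where
  "reflects_into K r w \<longleftrightarrow> (\<forall>x\<in>K. \<exists>y\<in>K. x + r *\<^sub>R y = w)"

lemma banach_mazur_eq: "banach_mazur K L = Inf {r. sandwich_factor K L r}"
  by (simp add: banach_mazur_def sandwich_factor_def)

text \<open>
  The centre of the reflection is always an interior point: if K \<subseteq> w - r K, then the fixed
  point z = w/(1+r) of the reflection is a convex combination with positive weights of any point k and the
  y paired with it, so it is interior as soon as k is.
\<close>
lemma asymmetry_eq:
  assumes K: "convex K" "interior K \<noteq> {}"
  shows "asymmetry K = Inf {r. r > 0 \<and> (\<exists>w. reflects_into K r w)}"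
proof -
  have "(\<exists>z \<in> interior K. (\<lambda>x. x - z) ` K \<subseteq> (\<lambda>x. (- r) *\<^sub>R x) ` (\<lambda>x. x - z) ` K)
      \<longleftrightarrow> (\<exists>w. reflects_into K r w)" if r: "r > 0" for r
  proof
    assume "\<exists>z \<in> interior K. (\<lambda>x. x - z) ` K \<subseteq> (\<lambda>x. (- r) *\<^sub>R x) ` (\<lambda>x. x - z) ` K"
    then obtain z where z: "(\<lambda>x. x - z) ` K \<subseteq> (\<lambda>x. (- r) *\<^sub>R x) ` (\<lambda>x. x - z) ` K" by blast
    have "\<exists>y\<in>K. x + r *\<^sub>R y = (1 + r) *\<^sub>R z" if "x \<in> K" for x
    proof -
      obtain y where "y \<in> K" "x - z = (- r) *\<^sub>R (y - z)" using z \<open>x \<in> K\<close> by blast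
      then have "x + r *\<^sub>R y = (1 + r) *\<^sub>R z" by (simp add: algebra_simps)
      then show ?thesis using \<open>y \<in> K\<close> by blast
    qed
    then show "\<exists>w. reflects_into K r w" unfolding reflects_into_def by blast
  next
    assume "\<exists>w. reflects_into K r w"
    then obtain w where w: "\<And>x. x \<in> K \<Longrightarrow> \<exists>y\<in>K. x + r *\<^sub>R y = w"
      unfolding reflects_into_def by blast
    define z where "z = w /\<^sub>R (1 + r)"
    have wz: "w = (1 + r) *\<^sub>R z" using r by (simp add: z_def)
    obtain k where k: "k \<in> interior K" using K(2) by blast
    then have "k \<in> K" using interior_subset by blast
    then obtain y where y: "y \<in> K" "k + r *\<^sub>R y = w" using w by blast
    have "y - (1 / (1 + r)) *\<^sub>R (y - k) \<in> interior K"
      by (rule mem_interior_convex_shrink[OF K(1) k y(1)]) (use r in auto)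
    moreover have "y - (1 / (1 + r)) *\<^sub>R (y - k) = z"
    proof -
      have "(1 + r) *\<^sub>R (y - (1 / (1 + r)) *\<^sub>R (y - k)) = (1 + r) *\<^sub>R z"
        using r y(2) wz by (simp add: scaleR_diff_right) (simp add: algebra_simps)
      then show ?thesis using r by simp
    qed
    ultimately have "z \<in> interior K" by simp
    moreover have "(\<lambda>x. x - z) ` K \<subseteq> (\<lambda>x. (- r) *\<^sub>R x) ` (\<lambda>x. x - z) ` K"
    proof
      fix p assume "p \<in> (\<lambda>x. x - z) ` K"
      then obtain x where x: "x \<in> K" "p = x - z" by blast
      then obtain y where y: "y \<in> K" "x + r *\<^sub>R y = (1 + r) *\<^sub>R z" using w wz by blast
      have "x = (1 + r) *\<^sub>R z - r *\<^sub>R y" using y(2) by (simp add: eq_diff_eq)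
      then have "p = (- r) *\<^sub>R (y - z)" unfolding x(2) by (simp add: scaleR_left_distrib scaleR_diff_right)
      then show "p \<in> (\<lambda>x. (- r) *\<^sub>R x) ` (\<lambda>x. x - z) ` K" using y(1) by blast
    qed
    ultimately show "\<exists>z \<in> interior K. (\<lambda>x. x - z) ` K \<subseteq> (\<lambda>x. (- r) *\<^sub>R x) ` (\<lambda>x. x - z) ` K"
      by blast
  qed
  then show ?thesis unfolding asymmetry_def by (intro arg_cong[where f = Inf]) blast
qed

text \<open>
  Reflecting in the centre of L maps the outer homothet of K to a reflected one that still
  contains L, hence the inner copy of K. This gives the lower bound as(K) for all distances.
\<close>
lemma sandwich_factor_reflects:
  assumes "sandwich_factor K L r" "centrally_symmetric L"
  shows "\<exists>w. reflects_into K r w"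
proof -
  obtain T u v where T: "linear T" and
     sub: "(\<lambda>x. x + u) ` K \<subseteq> T ` (\<lambda>x. x + v) ` L"
     "T ` (\<lambda>x. x + v) ` L \<subseteq> (\<lambda>x. r *\<^sub>R x) ` (\<lambda>x. x + u) ` K"
    using assms(1) unfolding sandwich_factor_def by blast
  obtain c where c: "(\<lambda>x. 2 *\<^sub>R c - x) ` L = L"
    using assms(2) unfolding centrally_symmetric_def by blast
  have "\<exists>y\<in>K. x + r *\<^sub>R y = T (2 *\<^sub>R c + 2 *\<^sub>R v) - (1 + r) *\<^sub>R u" if "x \<in> K" for x
  proof -
    obtain l where l: "l \<in> L" "x + u = T (l + v)" using sub(1) \<open>x \<in> K\<close> by blast
    have "2 *\<^sub>R c - l \<in> L" using c l(1) by blast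
    then obtain y where y: "y \<in> K" "T (2 *\<^sub>R c - l + v) = r *\<^sub>R (y + u)" using sub(2) by blast
    have "(x + u) + r *\<^sub>R (y + u) = T ((l + v) + (2 *\<^sub>R c - l + v))"
      using l y linear_add[OF T] by metis
    also have "(l + v) + (2 *\<^sub>R c - l + v) = 2 *\<^sub>R c + 2 *\<^sub>R v" by (simp add: algebra_simps scaleR_2)
    finally have "x + r *\<^sub>R y = T (2 *\<^sub>R c + 2 *\<^sub>R v) - (1 + r) *\<^sub>R u"
      by (simp add: algebra_simps)
    then show ?thesis using y(1) by blast
  qed
  then show ?thesis unfolding reflects_into_def by blast
qed

text \<open>
  Since every distance to a symmetric body is at least the asymmetry, attaining r for every L
  while no smaller ratio reflects K into itself settles both quantities. A ball serves as a
  particular L to see that r itself reflects K into itself.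
\<close>
lemma equidistant_to_symmetricI:
  fixes K :: "(real^2) set"
  assumes K: "convex K" "interior K \<noteq> {}"
    and lower: "\<And>\<rho> w. \<rho> > 0 \<Longrightarrow> reflects_into K \<rho> w \<Longrightarrow> r \<le> \<rho>"
    and upper: "\<And>L. convex_body L \<Longrightarrow> centrally_symmetric L \<Longrightarrow> sandwich_factor K L r"
  shows "equidistant_to_symmetric K r"
proof -
  have r: "r > 0 \<and> (\<exists>w. reflects_into K r w)"
  proof -
    have "convex_body (cball (0::real^2) 1)" by (simp add: convex_body_def)
    moreover have cs: "centrally_symmetric (cball (0::real^2) 1)"
      unfolding centrally_symmetric_def
      by (rule exI[of _ 0]) (auto simp: image_def intro!: bexI[of _ "- x" for x])
    ultimately have *: "sandwich_factor K (cball 0 1) r" using upper by blast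
    then show ?thesis using sandwich_factor_reflects[OF * cs] by (auto simp: sandwich_factor_def)
  qed
  have "asymmetry K = r"
    unfolding asymmetry_eq[OF K] by (rule cInf_eq_minimum) (use r lower in auto)
  moreover have "banach_mazur K L = r" if "convex_body L" "centrally_symmetric L" for L
    unfolding banach_mazur_eq
  proof (rule cInf_eq_minimum)
    show "r \<in> {r. sandwich_factor K L r}" using upper that by blast
    fix x assume "x \<in> {r. sandwich_factor K L r}"
    then have "x > 0 \<and> (\<exists>w. reflects_into K x w)"
      using sandwich_factor_reflects[OF _ that(2)] by (auto simp: sandwich_factor_def)
    then show "r \<le> x" using lower by blast
  qed
  ultimately show ?thesis unfolding equidistant_to_symmetric_def by blast
qed

text \<open>
  The outer body may be translated freely: for r \<noteq> 1 the map x \<mapsto> r x + b is a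
  homothety, and moving its centre to the origin brings the sandwich into the required form.
\<close>
lemma sandwich_factorI:
  fixes K L :: "(real^'n) set"
  assumes T: "linear T" "bij T" and r: "r > 1"
    and sub: "K \<subseteq> T ` (\<lambda>x. x + v) ` L" "T ` (\<lambda>x. x + v) ` L \<subseteq> (\<lambda>x. r *\<^sub>R x + b) ` K"
  shows "sandwich_factor K L r"
proof -
  define u where "u = b /\<^sub>R (r - 1)"
  have b: "b = (r - 1) *\<^sub>R u" using r by (simp add: u_def)
  obtain s where s: "T s = u" using T(2) by (metis bij_pointE)
  have tr: "T (x + (v + s)) = T (x + v) + u" for x
    using linear_add[OF T(1), of "x + v" s] s by (simp add: add.assoc)
  have "(\<lambda>x. x + u) ` K \<subseteq> T ` (\<lambda>x. x + (v + s)) ` L"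
    using sub(1) by (force simp: image_image tr)
  moreover have "T ` (\<lambda>x. x + (v + s)) ` L \<subseteq> (\<lambda>x. r *\<^sub>R x) ` (\<lambda>x. x + u) ` K"
  proof
    fix p assume "p \<in> T ` (\<lambda>x. x + (v + s)) ` L"
    then obtain l where l: "l \<in> L" "p = T (l + v) + u" using tr by auto
    then obtain k where k: "k \<in> K" "T (l + v) = r *\<^sub>R k + b" using sub(2) by blast
    have "p = r *\<^sub>R (k + u)" using l k b by (simp add: algebra_simps)
    then show "p \<in> (\<lambda>x. r *\<^sub>R x) ` (\<lambda>x. x + u) ` K" using k by blast
  qed
  ultimately have "\<exists>T u v. linear T \<and> bij T \<and>
     (\<lambda>x. x + u) ` K \<subseteq> T ` (\<lambda>x. x + v) ` L \<and>
     T ` (\<lambda>x. x + v) ` L \<subseteq> (\<lambda>x. r *\<^sub>R x) ` (\<lambda>x. x + u) ` K"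
    using T by blast
  then show ?thesis unfolding sandwich_factor_def using r by simp
qed

section \<open>Symmetric bodies in the position of a largest triangle\<close>

definition pt :: "real \<Rightarrow> real \<Rightarrow> real^2" where "pt x y = vector [x, y]"

lemma pt_nth [simp]: "pt x y $ 1 = x" "pt x y $ 2 = y" by (simp_all add: pt_def)

lemma vec_eq_iff_2: "x = y \<longleftrightarrow> x $ 1 = y $ 1 \<and> x $ 2 = (y::real^2) $ 2"
  by (auto simp: vec_eq_iff forall_2)

definition cross :: "real^2 \<Rightarrow> real^2 \<Rightarrow> real" where
  "cross a b = a $ 1 * b $ 2 - a $ 2 * b $ 1"

lemma cross_simps:
  "cross (a + b) c = cross a c + cross b c" "cross c (a + b) = cross c a + cross c b"
  "cross (a - b) c = cross a c - cross b c" "cross c (a - b) = cross c a - cross c b"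
  "cross (k *\<^sub>R a) c = k * cross a c" "cross c (k *\<^sub>R a) = k * cross c a"
  "cross a a = 0"
  by (simp_all add: cross_def algebra_simps)

lemma cramer_2: "cross a b *\<^sub>R z = cross z b *\<^sub>R a + cross a z *\<^sub>R b"
  by (simp add: vec_eq_iff_2 cross_def algebra_simps)

lemma plane_coordinates:
  assumes "cross a b \<noteq> 0"
  obtains T where "linear T" "bij T" "T a = pt 1 0" "T b = pt 0 1"
    "\<And>z. z = T z $ 1 *\<^sub>R a + T z $ 2 *\<^sub>R b"
    "\<And>z. T z $ 1 = cross z b / cross a b" "\<And>z. T z $ 2 = cross a z / cross a b"
proof -
  define T where "T z = pt (cross z b / cross a b) (cross a z / cross a b)" for z
  have "linear T"
    by (rule linearI) (simp_all add: T_def vec_eq_iff_2 cross_simps(1,2,5,6) add_divide_distrib)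
  define S where "S z = (z $ 1) *\<^sub>R a + (z $ 2) *\<^sub>R b" for z :: "real^2"
  have TS: "T (S z) = z" for z
    using assms(1) by (simp add: T_def S_def vec_eq_iff_2 cross_simps(1,2,5,6,7))
  have ST: "S (T z) = z" for z
  proof -
    have "cross a b *\<^sub>R S (T z) = cross z b *\<^sub>R a + cross a z *\<^sub>R b"
      using assms(1) by (simp add: T_def S_def scaleR_add_right)
    then show ?thesis using assms(1) by (simp add: cramer_2[symmetric])
  qed
  have "bij T" by (rule o_bij[of S]) (auto simp: fun_eq_iff TS ST)
  moreover have "T a = pt 1 0" "T b = pt 0 1"
    using assms(1) by (simp_all add: T_def vec_eq_iff_2 cross_simps(7))
  moreover have "z = T z $ 1 *\<^sub>R a + T z $ 2 *\<^sub>R b" for z using ST[of z] by (simp add: S_def)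
  ultimately show ?thesis using that \<open>linear T\<close> by (simp add: T_def)
qed

text \<open>
  Twice the signed area of a triangle.
\<close>
definition tri :: "real^2 \<Rightarrow> real^2 \<Rightarrow> real^2 \<Rightarrow> real" where
  "tri a b c = cross (b - a) (c - a)"

lemma tri_rotate: "tri b c a = tri a b c"
  by (simp add: tri_def cross_def algebra_simps)

lemma tri_sum: "tri m b c + tri m c a + tri m a b = tri a b c"
  by (simp add: tri_def cross_def algebra_simps)

lemma largest_triangle:
  assumes "compact L" "interior L \<noteq> {}"
  obtains a b c where "a \<in> L" "b \<in> L" "c \<in> L" "tri a b c \<noteq> 0"
    "\<And>x y z. x \<in> L \<Longrightarrow> y \<in> L \<Longrightarrow> z \<in> L \<Longrightarrow> \<bar>tri x y z\<bar> \<le> \<bar>tri a b c\<bar>"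
proof -
  let ?f = "\<lambda>(x, y, z). \<bar>tri x y z\<bar>"
  obtain k e where e: "e > 0" "cball k e \<subseteq> L"
    using assms(2) by (metis all_not_in_conv mem_interior_cball)
  have kL: "k \<in> L" "k + e *\<^sub>R axis 1 1 \<in> L" "k + e *\<^sub>R axis 2 1 \<in> L"
    using e by (auto simp: subset_iff dist_norm)
  have "compact (L \<times> L \<times> L)" using assms(1) by (intro compact_Times)
  moreover have "L \<times> L \<times> L \<noteq> {}" using kL by auto
  moreover have "continuous_on (L \<times> L \<times> L) ?f"
    unfolding tri_def cross_def split_def by (intro continuous_intros)
  ultimately have "\<exists>p\<in>L \<times> L \<times> L. \<forall>q\<in>L \<times> L \<times> L. ?f q \<le> ?f p"
    by (rule continuous_attains_sup)
  then obtain p where p: "p \<in> L \<times> L \<times> L" "\<forall>q\<in>L \<times> L \<times> L. ?f q \<le> ?f p" by blast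
  obtain a b c where abc: "p = (a, b, c)" by (cases p) auto
  have max: "\<bar>tri x y z\<bar> \<le> \<bar>tri a b c\<bar>" if "x \<in> L" "y \<in> L" "z \<in> L" for x y z
    using p(2)[rule_format, of "(x, y, z)"] that abc by simp
  have "tri k (k + e *\<^sub>R axis 1 1) (k + e *\<^sub>R axis 2 1) = e * e"
    by (simp add: tri_def cross_def axis_def)
  then have "tri a b c \<noteq> 0" using max[OF kL] mult_pos_pos[OF e(1) e(1)] by auto
  then show ?thesis using that[of a b c] p(1) abc max by auto
qed

text \<open>
  In coordinates adapted to a largest triangle with vertices 0, (1,0), (0,1), replacing one
  vertex by a point p of L multiplies the area by a barycentric coordinate of p, which is therefore at
  most 1 in absolute value; this gives the three half-planes. The triangle inherits the numbering
  freedom of its vertices, and a cyclic rotation keeps the sign of its area, so the vertex sent to 0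
  can be the one at which the centre has its least barycentric coordinate.
\<close>
lemma triangle_position:
  fixes L :: "(real^2) set"
  assumes L: "convex_body L" "centrally_symmetric L"
  obtains T v m where "linear T" "bij T"
    "{0, pt 1 0, pt 0 1} \<subseteq> T ` (\<lambda>x. x + v) ` L"
    "\<And>p. p \<in> T ` (\<lambda>x. x + v) ` L \<Longrightarrow> 2 *\<^sub>R m - p \<in> T ` (\<lambda>x. x + v) ` L"
    "\<And>p. p \<in> T ` (\<lambda>x. x + v) ` L \<Longrightarrow> p $ 1 \<le> 1 \<and> p $ 2 \<le> 1 \<and> 0 \<le> p $ 1 + p $ 2"
    "1 - m $ 1 - m $ 2 \<le> m $ 1" "1 - m $ 1 - m $ 2 \<le> m $ 2"
proof -
  obtain c where c: "(\<lambda>x. 2 *\<^sub>R c - x) ` L = L"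
    using L(2) unfolding centrally_symmetric_def by blast
  obtain a b d where *: "a \<in> L" "b \<in> L" "d \<in> L" "tri a b d \<noteq> 0"
    "\<And>x y z. x \<in> L \<Longrightarrow> y \<in> L \<Longrightarrow> z \<in> L \<Longrightarrow> \<bar>tri x y z\<bar> \<le> \<bar>tri a b d\<bar>"
    using largest_triangle[of L] L(1) unfolding convex_body_def by metis
  define \<mu> where "\<mu> x y = tri c x y / tri a b d" for x y
  have "\<exists>P0 P1 P2. P0 \<in> L \<and> P1 \<in> L \<and> P2 \<in> L \<and> tri P0 P1 P2 = tri a b d \<and>
      \<mu> P1 P2 \<le> \<mu> P2 P0 \<and> \<mu> P1 P2 \<le> \<mu> P0 P1"
  proof -
    have rot: "tri b d a = tri a b d" "tri d a b = tri a b d" by (metis tri_rotate)+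
    consider "\<mu> b d \<le> \<mu> d a \<and> \<mu> b d \<le> \<mu> a b" | "\<mu> d a \<le> \<mu> a b \<and> \<mu> d a \<le> \<mu> b d"
      | "\<mu> a b \<le> \<mu> b d \<and> \<mu> a b \<le> \<mu> d a" by linarith
    then show ?thesis
    proof cases
      case 1 then show ?thesis using *(1-3) by blast
    next
      case 2 then show ?thesis using *(1-3) rot by blast
    next
      case 3 then show ?thesis using *(1-3) rot by blast
    qed
  qed
  then obtain P0 P1 P2 where P: "P0 \<in> L" "P1 \<in> L" "P2 \<in> L" and t: "tri P0 P1 P2 = tri a b d"
    and \<mu>: "\<mu> P1 P2 \<le> \<mu> P2 P0" "\<mu> P1 P2 \<le> \<mu> P0 P1" by blast
  define D where "D = tri P0 P1 P2"
  have D: "D \<noteq> 0" "D = cross (P1 - P0) (P2 - P0)" using *(4) t by (simp_all add: D_def tri_def)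
  have max: "\<bar>tri x y z\<bar> \<le> \<bar>D\<bar>" if "x \<in> L" "y \<in> L" "z \<in> L" for x y z
    using *(5) that t by (simp add: D_def)
  have "cross (P1 - P0) (P2 - P0) \<noteq> 0" using D by simp
  then obtain T where T: "linear T" "bij T" "T (P1 - P0) = pt 1 0" "T (P2 - P0) = pt 0 1"
    "\<And>z. z = T z $ 1 *\<^sub>R (P1 - P0) + T z $ 2 *\<^sub>R (P2 - P0)"
    "\<And>z. T z $ 1 = cross z (P2 - P0) / D" "\<And>z. T z $ 2 = cross (P1 - P0) z / D"
    unfolding D(2) using plane_coordinates by blast
  note lin = T(1) and bij = T(2)
  let ?M = "T ` (\<lambda>x. x + (- P0)) ` L"
  have in_M: "\<exists>l\<in>L. p = T (l - P0)" if "p \<in> ?M" for p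
  proof -
    from that obtain l where "l \<in> L" "p = T (l + (- P0))" by blast
    then show ?thesis by auto
  qed
  have M_in: "T (l - P0) \<in> ?M" if "l \<in> L" for l
  proof -
    have "T (l + (- P0)) \<in> ?M" using that by blast
    then show ?thesis by simp
  qed
  define m where "m = T (c - P0)"
  have T1: "T 0 = 0" "T (P1 - P0) = pt 1 0" "T (P2 - P0) = pt 0 1"
    using T(3,4) linear_0[OF lin] by auto
  have A: "{0, pt 1 0, pt 0 1} \<subseteq> ?M"
  proof -
    from M_in[OF P(1)] M_in[OF P(2)] M_in[OF P(3)] show ?thesis using T1 by simp
  qed
  have sym: "2 *\<^sub>R m - p \<in> ?M" if pM: "p \<in> ?M" for p
  proof -
    obtain l where l: "l \<in> L" "p = T (l - P0)" using in_M[OF pM] by blast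
    have "2 *\<^sub>R m - p = T ((2 *\<^sub>R c - l) - P0)"
      unfolding m_def l(2) linear_diff[OF lin] linear_scale[OF lin] by (simp add: algebra_simps scaleR_2)
    moreover have "2 *\<^sub>R c - l \<in> L" using c l(1) by blast
    ultimately show ?thesis using M_in by simp
  qed
  have half: "p $ 1 \<le> 1 \<and> p $ 2 \<le> 1 \<and> 0 \<le> p $ 1 + p $ 2" if pM: "p \<in> ?M" for p
  proof -
    obtain l where l: "l \<in> L" "p = T (l - P0)" using in_M[OF pM] by blast
    have l0: "l - P0 = p $ 1 *\<^sub>R (P1 - P0) + p $ 2 *\<^sub>R (P2 - P0)" using T(5) l(2) by blast
    have e1: "tri P0 l P2 = (p $ 1) * D" "tri P0 P1 l = (p $ 2) * D"
      unfolding tri_def l0 D(2) by (simp_all add: cross_simps(1,2,5,6,7))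
    have "tri l P1 P2 = tri P0 P1 P2 - tri P0 l P2 - tri P0 P1 l"
      by (simp add: tri_def cross_def algebra_simps)
    then have e: "tri P0 l P2 = (p $ 1) * D" "tri P0 P1 l = (p $ 2) * D"
        "tri l P1 P2 = (1 - p $ 1 - p $ 2) * D"
      using e1 by (simp_all add: D_def algebra_simps)
    have "\<bar>p $ 1\<bar> * \<bar>D\<bar> \<le> 1 * \<bar>D\<bar>" "\<bar>p $ 2\<bar> * \<bar>D\<bar> \<le> 1 * \<bar>D\<bar>" "\<bar>1 - p $ 1 - p $ 2\<bar> * \<bar>D\<bar> \<le> 1 * \<bar>D\<bar>"
      using max[of P0 l P2] max[of P0 P1 l] max[of l P1 P2] P l(1) unfolding e abs_mult by auto
    then have "\<bar>p $ 1\<bar> \<le> 1" "\<bar>p $ 2\<bar> \<le> 1" "\<bar>1 - p $ 1 - p $ 2\<bar> \<le> 1"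
      using D(1) by (meson mult_le_cancel_right_pos zero_less_abs_iff)+
    then show ?thesis by linarith
  qed
  have m: "\<mu> P2 P0 = m $ 1" "\<mu> P0 P1 = m $ 2"
    by (simp_all add: \<mu>_def m_def T(6,7) t[symmetric] D_def[symmetric]) (simp_all add: tri_def cross_def algebra_simps)
  have "\<mu> P1 P2 + \<mu> P2 P0 + \<mu> P0 P1 = 1"
    using tri_sum[of c P1 P2 P0] D(1) t by (simp add: \<mu>_def D_def add_divide_distrib[symmetric])
  then have least: "1 - m $ 1 - m $ 2 \<le> m $ 1" "1 - m $ 1 - m $ 2 \<le> m $ 2"
    using \<mu> m by auto
  show ?thesis by (rule that[OF lin bij A]) (fact sym half least)+
qed

section \<open>Pentagons equidistant to all symmetric bodies\<close>

text \<open>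
  The standard triangle, enlarged by two points on the line x + y = s beyond its long side.
\<close>
definition pentagon :: "real \<Rightarrow> real \<Rightarrow> (real^2) set" where
  "pentagon s t = convex hull {0, pt 1 0, pt (s - t) t, pt t (s - t), pt 0 1}"

text \<open>
  The lower bound on t makes every symmetric body in triangle position contain the pentagon, the upper
  bound places that body inside the reflected pentagon.
\<close>
definition admissible :: "real \<Rightarrow> real \<Rightarrow> bool" where
  "admissible s t \<longleftrightarrow> 1 < s \<and> 2 * (s - 1) \<le> t \<and> t \<le> s / 4"

lemma convexD_3:
  assumes "convex C" "x \<in> C" "y \<in> C" "z \<in> C" "0 \<le> a" "0 \<le> b" "0 \<le> c" "a + b + c = (1::real)"
  shows "a *\<^sub>R x + b *\<^sub>R y + c *\<^sub>R z \<in> C"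
proof -
  have "convex hull {x, y, z} \<subseteq> C" by (rule hull_minimal) (use assms in auto)
  moreover have "a *\<^sub>R x + b *\<^sub>R y + c *\<^sub>R z \<in> convex hull {x, y, z}"
    unfolding convex_hull_3 using assms by blast
  ultimately show ?thesis by blast
qed

lemma convex_combination_3:
  assumes "convex C" "0 \<in> C" "x \<in> C" "y \<in> C" "0 \<le> a" "0 \<le> b" "a + b \<le> (1::real)"
  shows "a *\<^sub>R x + b *\<^sub>R y \<in> C"
proof -
  have "a *\<^sub>R x + b *\<^sub>R y + (1 - a - b) *\<^sub>R 0 \<in> C"
    by (rule convexD_3[OF assms(1,3,4,2)]) (use assms in auto)
  then show ?thesis by simp
qed

text \<open>
  The five edges of the pentagon. The last two, through (1,0) and (s-t,t) and through (0,1) and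
  (t,s-t), are kept free of the denominator t.
\<close>
definition pentagon_region :: "real \<Rightarrow> real \<Rightarrow> (real^2) set" where
  "pentagon_region s t = {p. 0 \<le> p $ 1 \<and> 0 \<le> p $ 2 \<and> p $ 1 + p $ 2 \<le> s \<and>
     t * p $ 1 + (t - (s - 1)) * p $ 2 \<le> t \<and> (t - (s - 1)) * p $ 1 + t * p $ 2 \<le> t}"

lemma pentagon_subset:
  assumes "convex C" "0 \<in> C" "pt 1 0 \<in> C" "pt (s - t) t \<in> C" "pt t (s - t) \<in> C" "pt 0 1 \<in> C"
  shows "pentagon s t \<subseteq> C"
  unfolding pentagon_def by (rule hull_minimal) (use assms in auto)

lemma pentagon_vertices:
  "0 \<in> pentagon s t" "pt 1 0 \<in> pentagon s t" "pt (s - t) t \<in> pentagon s t"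
  "pt t (s - t) \<in> pentagon s t" "pt 0 1 \<in> pentagon s t"
  unfolding pentagon_def by (auto intro: hull_inc)

lemma convex_pentagon_region: "convex (pentagon_region s t)"
proof -
  have "pentagon_region s t = {p. inner (pt (-1) 0) p \<le> 0} \<inter> {p. inner (pt 0 (-1)) p \<le> 0} \<inter>
     {p. inner (pt 1 1) p \<le> s} \<inter> {p. inner (pt t (t - (s - 1))) p \<le> t} \<inter>
     {p. inner (pt (t - (s - 1)) t) p \<le> t}"
    by (auto simp: pentagon_region_def inner_vec_def sum_2)
  then show ?thesis by (simp only:) (intro convex_Int convex_halfspace_le)
qed

text \<open>
  For the non-trivial inclusion the region is cut into three triangles by the rays from 0 through
  (s-t,t) and (t,s-t); in each of them the coefficients of a point with respect to the two
  vertices are explicit, and their sum is at most 1 by the inequality of the opposite edge.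
\<close>
lemma pentagon_eq_region:
  assumes "admissible s t"
  shows "pentagon s t = pentagon_region s t"
proof
  have st: "1 < s" "2 * (s - 1) \<le> t" "t \<le> s / 4" "0 < t" using assms by (auto simp: admissible_def)
  have e: "t * (s - t) + (t - (s - 1)) * t = t" "(t - (s - 1)) * (s - t) + t * t = t - (s - 2 * t) * (s - 1)"
     "t * t + (t - (s - 1)) * (s - t) = t - (s - 2 * t) * (s - 1)" "(t - (s - 1)) * t + t * (s - t) = t"
    by (simp_all add: algebra_simps)
  have pos: "(s - 2 * t) * (s - 1) \<ge> 0" using st by (intro mult_nonneg_nonneg) auto
  show "pentagon s t \<subseteq> pentagon_region s t"
  proof (rule pentagon_subset[OF convex_pentagon_region])
    show "pt (s - t) t \<in> pentagon_region s t" "pt t (s - t) \<in> pentagon_region s t"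
      unfolding pentagon_region_def mem_Collect_eq pt_nth e using st pos by linarith+
  qed (use st in \<open>simp_all add: pentagon_region_def\<close>)
  have conv: "convex (pentagon s t)" by (simp add: pentagon_def convex_convex_hull)
  show "pentagon_region s t \<subseteq> pentagon s t"
  proof
    fix p assume "p \<in> pentagon_region s t"
    then have p: "0 \<le> p $ 1" "0 \<le> p $ 2" "p $ 1 + p $ 2 \<le> s"
      "t * p $ 1 + (t - (s - 1)) * p $ 2 \<le> t" "(t - (s - 1)) * p $ 1 + t * p $ 2 \<le> t"
      by (auto simp: pentagon_region_def)
    note comb = convex_combination_3[OF conv pentagon_vertices(1)]
    consider "(s - t) * p $ 2 \<le> t * p $ 1" | "(s - t) * p $ 1 \<le> t * p $ 2"
      | "t * p $ 1 \<le> (s - t) * p $ 2" "t * p $ 2 \<le> (s - t) * p $ 1" by linarith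
    then show "p \<in> pentagon s t"
    proof cases
      case 1
      define b where "b = p $ 2 / t"
      have b: "p $ 2 = b * t" "b \<ge> 0" using st p(2) by (auto simp: b_def)
      have "t * (p $ 1) \<ge> t * ((s - t) * b)" using 1 b by (simp add: mult_ac)
      then have a: "p $ 1 - (s - t) * b \<ge> 0" using st(4) by simp
      have "t * (p $ 1 + (t - (s - 1)) * b) \<le> t * 1" using p(4) b(1) by (simp add: algebra_simps)
      then have "p $ 1 + (t - (s - 1)) * b \<le> 1" using st(4) by (simp add: mult_le_cancel_left_pos)
      then have "(p $ 1 - (s - t) * b) + b \<le> 1" by (simp add: algebra_simps)
      moreover have "p = (p $ 1 - (s - t) * b) *\<^sub>R pt 1 0 + b *\<^sub>R pt (s - t) t"
        using b by (simp add: vec_eq_iff_2)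
      ultimately show ?thesis using comb[OF pentagon_vertices(2,3) a b(2)] by metis
    next
      case 2
      define b where "b = p $ 1 / t"
      have b: "p $ 1 = b * t" "b \<ge> 0" using st p(1) by (auto simp: b_def)
      have "t * (p $ 2) \<ge> t * ((s - t) * b)" using 2 b by (simp add: mult_ac)
      then have a: "p $ 2 - (s - t) * b \<ge> 0" using st(4) by simp
      have "t * (p $ 2 + (t - (s - 1)) * b) \<le> t * 1" using p(5) b(1) by (simp add: algebra_simps)
      then have "p $ 2 + (t - (s - 1)) * b \<le> 1" using st(4) by (simp add: mult_le_cancel_left_pos)
      then have "(p $ 2 - (s - t) * b) + b \<le> 1" by (simp add: algebra_simps)
      moreover have "p = (p $ 2 - (s - t) * b) *\<^sub>R pt 0 1 + b *\<^sub>R pt t (s - t)"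
        using b by (simp add: vec_eq_iff_2)
      ultimately show ?thesis using comb[OF pentagon_vertices(5,4) a b(2)] by metis
    next
      case 3
      define d where "d = s * (s - 2 * t)"
      have d: "d > 0" "s > 0" using st by (auto simp: d_def)
      define a where "a = ((s - t) * p $ 1 - t * p $ 2) / d"
      define b where "b = ((s - t) * p $ 2 - t * p $ 1) / d"
      have ab0: "a \<ge> 0" "b \<ge> 0" using 3 d by (auto simp: a_def b_def)
      have ad: "d * a = (s - t) * p $ 1 - t * p $ 2" "d * b = (s - t) * p $ 2 - t * p $ 1"
        using d by (auto simp: a_def b_def)
      have "d * (s * (a + b)) = d * (p $ 1 + p $ 2)"
      proof -
        have "d * (s * (a + b)) = s * (d * a + d * b)" by (simp add: algebra_simps)
        then show ?thesis unfolding ad by (simp add: d_def algebra_simps)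
      qed
      then have "s * (a + b) \<le> s * 1" using d(1) p(3) by simp
      then have ab1: "a + b \<le> 1" using d(2) by (simp only: mult_le_cancel_left_pos)
      have "d * p $ 1 = d * (a * (s - t) + b * t)" "d * p $ 2 = d * (a * t + b * (s - t))"
      proof -
        have "d * (a * (s - t) + b * t) = (d * a) * (s - t) + (d * b) * t"
          "d * (a * t + b * (s - t)) = (d * a) * t + (d * b) * (s - t)"
          by (simp_all add: algebra_simps)
        then show "d * p $ 1 = d * (a * (s - t) + b * t)" "d * p $ 2 = d * (a * t + b * (s - t))"
          unfolding ad by (simp_all add: d_def algebra_simps)
      qed
      then have "p = a *\<^sub>R pt (s - t) t + b *\<^sub>R pt t (s - t)"
        using d(1) by (simp add: vec_eq_iff_2)
      then show ?thesis using comb[OF pentagon_vertices(3,4) ab0 ab1] by metis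
    qed
  qed
qed

lemma interior_pentagon: "interior (pentagon s t) \<noteq> {}"
proof -
  have "\<not> affine_dependent {0, pt 1 0, pt 0 1}"
  proof -
    have "independent {pt 1 0, pt 0 1}"
      by (subst independent_insert) (auto simp: span_singleton vec_eq_iff_2 dest: spec[of _ 1])
    then show ?thesis by (simp add: affine_dependent_iff_dependent vec_eq_iff_2)
  qed
  then have "interior (convex hull {0, pt 1 0, pt 0 1}) \<noteq> {}"
    by (subst interior_convex_hull_eq_empty) (auto simp: vec_eq_iff_2)
  moreover have "convex hull {0, pt 1 0, pt 0 1} \<subseteq> pentagon s t"
    unfolding pentagon_def by (rule hull_mono) auto
  then have "interior (convex hull {0, pt 1 0, pt 0 1}) \<subseteq> interior (pentagon s t)"
    by (rule interior_mono)
  ultimately show ?thesis by blast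
qed

text \<open>
  Evaluate the reflection on the three vertices 0, (1,0), (0,1) that touch the reflected copy: if
  x + \<rho> y = w, then the coordinates of w are at least 1, and their sum is at most \<rho> s.
\<close>
lemma pentagon_reflects_lower:
  assumes st: "admissible s t" and r: "\<rho> > 0" "reflects_into (pentagon s t) \<rho> w"
  shows "2 / s \<le> \<rho>"
proof -
  have s: "s > 0" using st by (simp add: admissible_def)
  have reg: "y \<in> pentagon_region s t" if "y \<in> pentagon s t" for y
    using that pentagon_eq_region[OF st] by simp
  obtain y where y: "y \<in> pentagon s t" "pt 1 0 + \<rho> *\<^sub>R y = w"
    using r(2) pentagon_vertices(2) unfolding reflects_into_def by blast
  obtain y' where y': "y' \<in> pentagon s t" "pt 0 1 + \<rho> *\<^sub>R y' = w"
    using r(2) pentagon_vertices(5) unfolding reflects_into_def by blast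
  obtain z where z: "z \<in> pentagon s t" "0 + \<rho> *\<^sub>R z = w"
    using r(2) pentagon_vertices(1) unfolding reflects_into_def by blast
  have "w $ 1 \<ge> 1" using reg[OF y(1)] r(1) y(2)[symmetric] by (simp add: pentagon_region_def)
  moreover have "w $ 2 \<ge> 1" using reg[OF y'(1)] r(1) y'(2)[symmetric] by (simp add: pentagon_region_def)
  moreover have "w $ 1 + w $ 2 = \<rho> * (z $ 1 + z $ 2)" using z(2)[symmetric] by (simp add: algebra_simps)
  moreover have "\<rho> * (z $ 1 + z $ 2) \<le> \<rho> * s"
    using reg[OF z(1)] r(1) by (simp add: pentagon_region_def)
  ultimately show ?thesis using s by (simp add: field_simps)
qed

text \<open>
  Let M be the image of L in triangle position with centre m and let \<open>\<mu>\<close> be its least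
  barycentric coordinate. The points (1,0), (0,1), 2m lie in M, and whatever m is, their triangle contains
  every point of the line x + y = s whose coordinates are both at least 2(s-1); the points (s-t,t) and
  (t,s-t) are of this kind. In the other direction, reflection in m turns x \<le> 1 into
  x \<ge> 2 m$1 - 1 \<ge> -1/2, and this bound is exactly what the two oblique edges need when t \<le> s/4.
\<close>
lemma pentagon_sandwich:
  assumes st: "admissible s t" and s2: "s < 2" and L: "convex_body L" "centrally_symmetric L"
  shows "sandwich_factor (pentagon s t) L (2 / s)"
proof -
  have st': "1 < s" "2 * (s - 1) \<le> t" "t \<le> s / 4" "0 < t" using st by (auto simp: admissible_def)
  obtain T v m where T: "linear T" "bij T"
    and M: "{0, pt 1 0, pt 0 1} \<subseteq> T ` (\<lambda>x. x + v) ` L"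
    "\<And>p. p \<in> T ` (\<lambda>x. x + v) ` L \<Longrightarrow> 2 *\<^sub>R m - p \<in> T ` (\<lambda>x. x + v) ` L"
    "\<And>p. p \<in> T ` (\<lambda>x. x + v) ` L \<Longrightarrow> p $ 1 \<le> 1 \<and> p $ 2 \<le> 1 \<and> 0 \<le> p $ 1 + p $ 2"
    and m: "1 - m $ 1 - m $ 2 \<le> m $ 1" "1 - m $ 1 - m $ 2 \<le> m $ 2"
    using triangle_position[OF L] by blast
  define M where "M = T ` (\<lambda>x. x + v) ` L"
  note M = M[folded M_def]
  have conv: "convex M" unfolding M_def
  proof (rule convex_linear_image[OF T(1)])
    have "(\<lambda>x. x + v) ` L = (+) v ` L" by (auto simp: add.commute)
    then show "convex ((\<lambda>x. x + v) ` L)" using L(1) by (simp add: convex_body_def convex_translation)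
  qed
  have m2: "2 *\<^sub>R m \<in> M" using M(2)[of 0] M(1) by simp
  have m12: "m $ 1 \<le> 1 / 2" "m $ 2 \<le> 1 / 2" using M(3)[OF m2] by auto
  have "2 *\<^sub>R m - pt 1 0 \<in> M" using M(2) M(1) by simp
  then have m0: "m $ 1 + m $ 2 \<ge> 1 / 2" using M(3) by fastforce
  define \<mu> where "\<mu> = 1 - m $ 1 - m $ 2"
  have \<mu>: "\<mu> \<le> m $ 1" "\<mu> \<le> m $ 2" "m $ 1 \<ge> 1/4" "m $ 2 \<ge> 1/4" "1 - 2 * \<mu> > 0"
      "m $ 1 \<le> 1 - 2 * \<mu>" "m $ 2 \<le> 1 - 2 * \<mu>"
    using m m12 by (auto simp: \<mu>_def)
  \<comment> \<open>The line x + y = s lies at this fraction of the way from the line x + y = 1 to the point 2m.\<close>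
  define g where "g = (s - 1) / (1 - 2 * \<mu>)"
  have g: "g * (1 - 2 * \<mu>) = s - 1" "g \<ge> 0" using \<mu> st' by (auto simp: g_def)
  have gm: "g * m $ 1 \<le> s - 1" "g * m $ 2 \<le> s - 1"
    using mult_left_mono[OF \<mu>(6) g(2)] mult_left_mono[OF \<mu>(7) g(2)] g(1) by auto
  have gsum: "g + (s - 1) = 2 * (g * m $ 1) + 2 * (g * m $ 2)"
    using g(1) by (simp add: \<mu>_def algebra_simps)
  have e: "pt 1 0 \<in> M" "pt 0 1 \<in> M" "0 \<in> M" using M(1) by auto
  have "(s - t - 2 * (g * m $ 1)) *\<^sub>R pt 1 0 + (t - 2 * (g * m $ 2)) *\<^sub>R pt 0 1 + g *\<^sub>R (2 *\<^sub>R m) \<in> M"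
    by (rule convexD_3[OF conv e(1,2) m2]) (use gm gsum st' g(2) in auto)
  then have A: "pt (s - t) t \<in> M" by (simp add: vec_eq_iff_2 algebra_simps back_subst[of "\<lambda>x. x \<in> M"])
  have "(t - 2 * (g * m $ 1)) *\<^sub>R pt 1 0 + (s - t - 2 * (g * m $ 2)) *\<^sub>R pt 0 1 + g *\<^sub>R (2 *\<^sub>R m) \<in> M"
    by (rule convexD_3[OF conv e(1,2) m2]) (use gm gsum st' g(2) in auto)
  then have B: "pt t (s - t) \<in> M" by (simp add: vec_eq_iff_2 algebra_simps back_subst[of "\<lambda>x. x \<in> M"])
  have inner: "pentagon s t \<subseteq> M" by (rule pentagon_subset[OF conv]) (use e A B in auto)
  have refl: "(s / 2) *\<^sub>R (pt 1 1 - p) \<in> pentagon s t" if p: "p \<in> M" for p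
  proof -
    have p1: "p $ 1 \<le> 1" "p $ 2 \<le> 1" "0 \<le> p $ 1 + p $ 2" using M(3)[OF p] by auto
    have p2: "p $ 1 \<ge> - 1 / 2" "p $ 2 \<ge> - 1 / 2" using M(3)[OF M(2)[OF p]] \<mu> by auto
    have cut: "s / 2 * (t * (1 - x) + (t - (s - 1)) * (1 - y)) \<le> t"
      if "0 \<le> x + y" "x \<ge> - 1 / 2" for x y
    proof -
      have "t * x + (t - (s - 1)) * y = (s - 1) * x + (t - (s - 1)) * (x + y)"
        by (simp add: algebra_simps)
      also have "\<dots> \<ge> (s - 1) * (- 1 / 2) + 0"
        using that st' by (intro add_mono mult_left_mono mult_nonneg_nonneg) auto
      finally have low: "t * x + (t - (s - 1)) * y \<ge> - (s - 1) / 2" by linarith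
      have "t * (1 - x) + (t - (s - 1)) * (1 - y) = 2 * t - (s - 1) - (t * x + (t - (s - 1)) * y)"
        by (simp add: algebra_simps)
      with low have 1: "t * (1 - x) + (t - (s - 1)) * (1 - y) \<le> 2 * t - (s - 1) / 2"
        by argo
      have "s / 2 * (t * (1 - x) + (t - (s - 1)) * (1 - y)) \<le> s / 2 * (2 * t - (s - 1) / 2)"
        by (rule mult_left_mono[OF 1]) (use st' in auto)
      also have "\<dots> = t + (s - 1) * (t - s / 4)" by (simp add: algebra_simps)
      also have "\<dots> \<le> t" using st' by (simp add: mult_nonneg_nonpos)
      finally show ?thesis .
    qed
    have pull: "a * (s / 2 * x) + b * (s / 2 * y) = s / 2 * (a * x + b * y)" for a b x y
      by (simp add: distrib_left mult_ac)
    have "(s / 2) *\<^sub>R (pt 1 1 - p) \<in> pentagon_region s t"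
      unfolding pentagon_region_def
    proof (intro CollectI conjI)
      show "t * ((s / 2) *\<^sub>R (pt 1 1 - p)) $ 1 + (t - (s - 1)) * ((s / 2) *\<^sub>R (pt 1 1 - p)) $ 2 \<le> t"
        unfolding vector_scaleR_component vector_minus_component pt_nth real_scaleR_def pull
        using cut p1 p2 by blast
      show "(t - (s - 1)) * ((s / 2) *\<^sub>R (pt 1 1 - p)) $ 1 + t * ((s / 2) *\<^sub>R (pt 1 1 - p)) $ 2 \<le> t"
        unfolding vector_scaleR_component vector_minus_component pt_nth real_scaleR_def pull
        using cut[of "p $ 2" "p $ 1"] p1 p2 by (simp only: add.commute)
      have "s / 2 * (2 - (p $ 1 + p $ 2)) \<le> s / 2 * 2"
        by (rule mult_left_mono) (use p1 st' in auto)
      then show "((s / 2) *\<^sub>R (pt 1 1 - p)) $ 1 + ((s / 2) *\<^sub>R (pt 1 1 - p)) $ 2 \<le> s"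
        by (simp add: algebra_simps)
    qed (use p1 st' in auto)
    then show ?thesis using pentagon_eq_region[OF st] by simp
  qed
  have outer: "M \<subseteq> (\<lambda>x. (2 / s) *\<^sub>R x + (2 *\<^sub>R m - pt 1 1)) ` pentagon s t"
  proof
    fix p assume "p \<in> M"
    then have "(s / 2) *\<^sub>R (pt 1 1 - (2 *\<^sub>R m - p)) \<in> pentagon s t" using refl M(2) by blast
    moreover have "p = (2 / s) *\<^sub>R ((s / 2) *\<^sub>R (pt 1 1 - (2 *\<^sub>R m - p))) + (2 *\<^sub>R m - pt 1 1)"
      using st' by simp
    ultimately show "p \<in> (\<lambda>x. (2 / s) *\<^sub>R x + (2 *\<^sub>R m - pt 1 1)) ` pentagon s t" by blast
  qed
  show ?thesis
    by (rule sandwich_factorI[OF T _ inner[unfolded M_def] outer[unfolded M_def]]) (use st' s2 in auto)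
qed

lemma pentagon_equidistant:
  assumes "admissible s t" "s < 2"
  shows "equidistant_to_symmetric (pentagon s t) (2 / s)"
  using assms by (intro equidistant_to_symmetricI interior_pentagon)
    (auto simp: pentagon_def convex_convex_hull intro: pentagon_sandwich[unfolded pentagon_def]
      pentagon_reflects_lower[unfolded pentagon_def])

definition vertices :: "real \<Rightarrow> real \<Rightarrow> (real^2) set" where
  "vertices s t = {0, pt 1 0, pt (s - t) t, pt t (s - t), pt 0 1}"

lemma extreme_point_of_hull_by_functional:
  fixes f :: "'a::euclidean_space"
  assumes "finite S" "v \<in> S" "\<And>w. w \<in> S \<Longrightarrow> w \<noteq> v \<Longrightarrow> f \<bullet> w < f \<bullet> v"
  shows "v extreme_point_of (convex hull S)"
proof -
  have "convex hull (S - {v}) \<subseteq> {x. f \<bullet> x < f \<bullet> v}"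
    by (rule hull_minimal) (use assms(3) in \<open>auto simp: convex_halfspace_lt\<close>)
  then have "v \<notin> convex hull (S - {v})" by auto
  then have "v extreme_point_of (convex hull (insert v (S - {v})))"
    using assms(1) by (intro extreme_point_of_convex_hull_insert) auto
  then show ?thesis using assms(2) by (simp add: insert_absorb)
qed

text \<open>
  Each vertex is the unique maximizer of a linear functional. For the two vertices on x + y = s
  the functional is a positive combination of the normals of the two edges that meet there.
\<close>
lemma extreme_points_pentagon:
  assumes "admissible s t"
  shows "{v. v extreme_point_of pentagon s t} = vertices s t"
proof
  have st: "1 < s" "2 * (s - 1) \<le> t" "t \<le> s / 4" "0 < t" "s - t > t" "s \<le> 8 / 7"
    using assms by (auto simp: admissible_def)
  show "{v. v extreme_point_of pentagon s t} \<subseteq> vertices s t"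
  proof
    fix v assume "v \<in> {v. v extreme_point_of pentagon s t}"
    then have "v extreme_point_of convex hull vertices s t" by (simp add: pentagon_def vertices_def)
    then show "v \<in> vertices s t" by (rule extreme_point_of_convex_hull)
  qed
  have in_hull: "v \<in> vertices s t \<Longrightarrow> (\<And>w. w \<in> vertices s t \<Longrightarrow> w \<noteq> v \<Longrightarrow> f \<bullet> w < f \<bullet> v) \<Longrightarrow>
      v extreme_point_of pentagon s t" for v f
    using extreme_point_of_hull_by_functional[of "vertices s t" v f]
    by (simp add: vertices_def pentagon_def)
  have ip: "pt a b \<bullet> p = a * p $ 1 + b * p $ 2" for a b p
    by (simp add: inner_vec_def sum_2)
  have e: "t * (s - t) + (t - (s - 1)) * t = t"
     "t * t + (t - (s - 1)) * (s - t) = t - (s - 2 * t) * (s - 1)"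
    by (simp_all add: algebra_simps)
  have pos: "(s - 2 * t) * (s - 1) > 0" "t * s > t" "t * s > 0" using st by auto
  \<comment> \<open>A positive combination of the outer normals of the edges meeting at (s-t,t).\<close>
  define f where "f x y = (t * x + (t - (s - 1)) * y) + t * (x + y)" for x y
  have f: "f (s - t) t = t + t * s" "f t (s - t) = (t - (s - 2 * t) * (s - 1)) + t * s"
    "f 1 0 = t + t" "f 0 1 = (t - (s - 1)) + t" "f 0 0 = 0"
    unfolding f_def e by simp_all
  have max: "f t (s - t) < f (s - t) t" "f 1 0 < f (s - t) t" "f 0 1 < f (s - t) t" "f 0 0 < f (s - t) t"
    unfolding f using st pos by linarith+
  have g: "pt (2 * t) (2 * t - (s - 1)) \<bullet> p = f (p $ 1) (p $ 2)"
    "pt (2 * t - (s - 1)) (2 * t) \<bullet> p = f (p $ 2) (p $ 1)" for p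
    by (simp_all add: ip f_def algebra_simps)
  show "vertices s t \<subseteq> {v. v extreme_point_of pentagon s t}"
  proof
    fix v assume "v \<in> vertices s t"
    then consider "v = 0" | "v = pt 1 0" | "v = pt 0 1" | "v = pt (s - t) t" | "v = pt t (s - t)"
      unfolding vertices_def by blast
    then show "v \<in> {v. v extreme_point_of pentagon s t}"
    proof cases
      case 1
      show ?thesis unfolding mem_Collect_eq
        by (rule in_hull[of _ "pt (-1) (-1)"]) (use st 1 in \<open>auto simp: vertices_def ip\<close>)
    next
      case 2
      show ?thesis unfolding mem_Collect_eq
        by (rule in_hull[of _ "pt 1 0"]) (use st 2 in \<open>auto simp: vertices_def ip\<close>)
    next
      case 3
      show ?thesis unfolding mem_Collect_eq
        by (rule in_hull[of _ "pt 0 1"]) (use st 3 in \<open>auto simp: vertices_def ip\<close>)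
    next
      case 4
      show ?thesis unfolding mem_Collect_eq
      proof (rule in_hull[of _ "pt (2 * t) (2 * t - (s - 1))"], unfold g 4)
        fix w assume "w \<in> vertices s t" "w \<noteq> pt (s - t) t"
        then show "f (w $ 1) (w $ 2) < f (pt (s - t) t $ 1) (pt (s - t) t $ 2)"
          using max by (auto simp: vertices_def)
      qed (simp add: vertices_def)
    next
      case 5
      show ?thesis unfolding mem_Collect_eq
      proof (rule in_hull[of _ "pt (2 * t - (s - 1)) (2 * t)"], unfold g 5)
        fix w assume "w \<in> vertices s t" "w \<noteq> pt t (s - t)"
        then show "f (w $ 2) (w $ 1) < f (pt t (s - t) $ 2) (pt t (s - t) $ 1)"
          using max by (auto simp: vertices_def)
      qed (simp add: vertices_def)
    qed
  qed
qed

lemma convex_pentagon_pentagon: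
  assumes "admissible s t"
  shows "convex_pentagon (pentagon s t)"
proof -
  have st: "1 < s" "2 * (s - 1) \<le> t" "t \<le> s / 4" "0 < t" using assms by (auto simp: admissible_def)
  have "card (vertices s t) = 5"
    unfolding vertices_def using st by (simp add: vec_eq_iff_2)
  moreover have "polytope (pentagon s t)"
    unfolding pentagon_def by (rule polytope_convex_hull) simp
  ultimately show ?thesis
    unfolding convex_pentagon_def by (simp add: extreme_points_pentagon[OF assms] interior_pentagon)
qed

section \<open>Affine inequivalence of the pentagons\<close>

text \<open>
  Twice the areas of the triangles spanned by vertices of the pentagon. Affine maps scale this set by
  a constant, so ratios of its elements are affine invariants.
\<close>
definition vertex_areas :: "real \<Rightarrow> real \<Rightarrow> real set" where
  "vertex_areas s t = {0, 1, t, s - t, s * (s - 2 * t), s - 1, (s - 2 * t) * (s - 1)}"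

lemma abs_tri_perm:
  "\<bar>tri a c b\<bar> = \<bar>tri a b c\<bar>" "\<bar>tri b a c\<bar> = \<bar>tri a b c\<bar>" "\<bar>tri b c a\<bar> = \<bar>tri a b c\<bar>"
  "\<bar>tri c a b\<bar> = \<bar>tri a b c\<bar>" "\<bar>tri c b a\<bar> = \<bar>tri a b c\<bar>"
proof -
  have "tri a c b = - tri a b c" "tri b a c = - tri a b c" "tri b c a = tri a b c"
    "tri c a b = tri a b c" "tri c b a = - tri a b c"
    by (simp_all add: tri_def cross_def algebra_simps)
  then show "\<bar>tri a c b\<bar> = \<bar>tri a b c\<bar>" "\<bar>tri b a c\<bar> = \<bar>tri a b c\<bar>" "\<bar>tri b c a\<bar> = \<bar>tri a b c\<bar>"
    "\<bar>tri c a b\<bar> = \<bar>tri a b c\<bar>" "\<bar>tri c b a\<bar> = \<bar>tri a b c\<bar>" by simp_all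
qed

lemma tri_degenerate: "tri a a b = 0" "tri a b a = 0" "tri b a a = 0"
  by (simp_all add: tri_def cross_def algebra_simps)

lemma tri_vertices:
  "tri 0 (pt 1 0) (pt (s - t) t) = t"
  "tri 0 (pt 1 0) (pt t (s - t)) = s - t"
  "tri 0 (pt 1 0) (pt 0 1) = 1"
  "tri 0 (pt (s - t) t) (pt t (s - t)) = s * (s - 2 * t)"
  "tri 0 (pt (s - t) t) (pt 0 1) = s - t"
  "tri 0 (pt t (s - t)) (pt 0 1) = t"
  "tri (pt 1 0) (pt (s - t) t) (pt t (s - t)) = (s - 2 * t) * (s - 1)"
  "tri (pt 1 0) (pt (s - t) t) (pt 0 1) = s - 1"
  "tri (pt 1 0) (pt t (s - t)) (pt 0 1) = s - 1"
  "tri (pt (s - t) t) (pt t (s - t)) (pt 0 1) = (s - 2 * t) * (s - 1)"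
  by (simp_all add: tri_def cross_def algebra_simps)

lemma abs_tri_vertices:
  assumes st: "admissible s t" and abc: "a \<in> vertices s t" "b \<in> vertices s t" "c \<in> vertices s t"
  shows "\<bar>tri a b c\<bar> \<in> vertex_areas s t"
proof -
  have st: "1 < s" "2 * (s - 1) \<le> t" "t \<le> s / 4" "0 < t" "s - 2 * t > 0"
    using st by (auto simp: admissible_def)
  have V: "\<bar>0\<bar> \<in> vertex_areas s t" "\<bar>1\<bar> \<in> vertex_areas s t" "\<bar>t\<bar> \<in> vertex_areas s t"
    "\<bar>s - t\<bar> \<in> vertex_areas s t" "\<bar>s * (s - 2 * t)\<bar> \<in> vertex_areas s t"
    "\<bar>s - 1\<bar> \<in> vertex_areas s t" "\<bar>(s - 2 * t) * (s - 1)\<bar> \<in> vertex_areas s t"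
    using st by (simp_all add: vertex_areas_def)
  define P where "P x y z \<longleftrightarrow> \<bar>tri x y z\<bar> \<in> vertex_areas s t" for x y z
  have sorted: "P x y z \<and> P x z y \<and> P y x z \<and> P y z x \<and> P z x y \<and> P z y x"
    if "P x y z" for x y z
    using that unfolding P_def by (metis abs_tri_perm)
  have deg: "P x x y \<and> P x y x \<and> P y x x" for x y
    using V(1) by (simp add: P_def tri_degenerate)
  obtain v0 v1 v2 v3 v4 where v: "vertices s t = {v0, v1, v2, v3, v4}"
    and "P v0 v1 v2" "P v0 v1 v3" "P v0 v1 v4" "P v0 v2 v3" "P v0 v2 v4"
      "P v0 v3 v4" "P v1 v2 v3" "P v1 v2 v4" "P v1 v3 v4" "P v2 v3 v4"
  proof (rule that)
    show "vertices s t = {0, pt 1 0, pt (s - t) t, pt t (s - t), pt 0 1}" by (rule vertices_def)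
  qed (use V in \<open>simp_all add: P_def tri_vertices\<close>)
  note areas = this(2-11)[THEN sorted]
  have "P a b c"
    using abc unfolding v by (elim insertE emptyE; hypsubst) (simp_all only: areas deg)
  then show ?thesis by (simp add: P_def)
qed

lemma affine_image_extreme_points:
  fixes T :: "real^2 \<Rightarrow> real^2"
  assumes "linear T" "bij T"
  shows "{v. v extreme_point_of (\<lambda>x. T x + c) ` K} = (\<lambda>x. T x + c) ` {v. v extreme_point_of K}"
proof -
  have inj: "inj T" using assms(2) bij_is_inj by blast
  have "(\<lambda>x. T x + c) ` X = (+) c ` T ` X" for X by (auto simp: image_image add.commute)
  moreover have "{v. v extreme_point_of T ` K} = T ` {v. v extreme_point_of K}"
  proof -
    have seg: "T x \<in> open_segment (T a) (T b) \<longleftrightarrow> x \<in> open_segment a b" for x a b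
      using open_segment_linear_image[OF assms(1) inj, of a b] inj by (auto dest: injD)
    show ?thesis
      unfolding extreme_point_of_def using seg inj by (auto simp: inj_image_mem_iff)
  qed
  ultimately show ?thesis by (simp add: extreme_points_of_translation)
qed

text \<open>
  An affine map multiplies areas by its determinant.
\<close>
lemma tri_affine_image:
  assumes "linear T"
  shows "tri (T x + c) (T y + c) (T z + c) = cross (T (pt 1 0)) (T (pt 0 1)) * tri x y z"
proof -
  have rep: "T p = p $ 1 *\<^sub>R T (pt 1 0) + p $ 2 *\<^sub>R T (pt 0 1)" for p
  proof -
    have "p = p $ 1 *\<^sub>R pt 1 0 + p $ 2 *\<^sub>R pt 0 1" by (simp add: vec_eq_iff_2)
    then have "T p = T (p $ 1 *\<^sub>R pt 1 0 + p $ 2 *\<^sub>R pt 0 1)" by simp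
    then show ?thesis by (simp only: linear_add[OF assms] linear_scale[OF assms])
  qed
  have "tri (T x + c) (T y + c) (T z + c) = cross (T (y - x)) (T (z - x))"
    by (simp add: tri_def linear_diff[OF assms])
  also have "\<dots> = cross (T (pt 1 0)) (T (pt 0 1)) * cross (y - x) (z - x)"
    unfolding rep[of "y - x"] rep[of "z - x"] by (simp add: cross_def algebra_simps)
  finally show ?thesis by (simp add: tri_def)
qed

lemma vertex_areas_bounds:
  assumes "admissible s t" "x \<in> vertex_areas s t"
  shows "x \<le> 1" "x = 0 \<or> (s - 2 * t) * (s - 1) \<le> x"
proof -
  have st: "1 < s" "2 * (s - 1) \<le> t" "t \<le> s / 4" using assms(1) by (auto simp: admissible_def)
  have d: "0 \<le> s - 2 * t" "s - 2 * t \<le> 4 - 3 * s" "s - 2 * t \<le> 1" "s \<le> 8 / 7" using st by auto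
  have "s * (s - 2 * t) \<le> s * (4 - 3 * s)" using st d by (intro mult_left_mono) auto
  also have "\<dots> = 1 - (s - 1) * (3 * s - 1)" by (simp add: algebra_simps)
  also have "\<dots> \<le> 1" using st by simp
  finally have 1: "s * (s - 2 * t) \<le> 1" .
  have 2: "(s - 2 * t) * (s - 1) \<le> 1 * (s - 1)" using st d by (intro mult_right_mono) auto
  have 3: "(s - 2 * t) * (s - 1) \<le> s * (s - 2 * t)"
    unfolding mult.commute[of s] using st d by (intro mult_left_mono) auto
  show "x \<le> 1" using assms(2) st d 1 2 unfolding vertex_areas_def by (elim insertE emptyE) linarith+
  define q where "q = (s - 2 * t) * (s - 1)"
  define w where "w = s * (s - 2 * t)"
  have "q \<le> s - 1" "q \<le> w" using 2 3 by (simp_all add: q_def w_def)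
  moreover have "x \<in> {0, 1, t, s - t, w, s - 1, q}"
    using assms(2) by (simp add: vertex_areas_def q_def w_def)
  ultimately have "q \<le> x" if "x \<noteq> 0" using that st d by (elim insertE emptyE) auto
  then show "x = 0 \<or> (s - 2 * t) * (s - 1) \<le> x" unfolding q_def by blast
qed

text \<open>
  An affine map between two pentagons permutes extreme points. Both area sets have the largest
  element 1, so the determinant has absolute value 1, and then the least positive elements agree.
\<close>
lemma affinely_equivalent_pentagons:
  assumes st: "admissible s t" "admissible s t'"
    and equiv: "affinely_equivalent (pentagon s t) (pentagon s t')"
  shows "t = t'"
proof -
  obtain T c where T: "linear T" "bij T" "pentagon s t' = (\<lambda>x. T x + c) ` pentagon s t"
    using equiv unfolding affinely_equivalent_def by blast
  define f where "f x = T x + c" for x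
  define \<delta> where "\<delta> = \<bar>cross (T (pt 1 0)) (T (pt 0 1))\<bar>"
  have V: "vertices s t' = f ` vertices s t"
    using affine_image_extreme_points[OF T(1,2), of c "pentagon s t"] extreme_points_pentagon st
    unfolding T(3)[symmetric] f_def by simp
  have area: "\<bar>tri (f x) (f y) (f z)\<bar> = \<delta> * \<bar>tri x y z\<bar>" for x y z
    by (simp add: f_def \<delta>_def tri_affine_image[OF T(1)] abs_mult)
  have in_V: "0 \<in> vertices s u" "pt 1 0 \<in> vertices s u" "pt (s - u) u \<in> vertices s u"
    "pt u (s - u) \<in> vertices s u" "pt 0 1 \<in> vertices s u" for u
    by (simp_all add: vertices_def)
  have push: "\<delta> * \<bar>tri x y z\<bar> \<in> vertex_areas s t'"
    if "x \<in> vertices s t" "y \<in> vertices s t" "z \<in> vertices s t" for x y z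
    using abs_tri_vertices[OF st(2), of "f x" "f y" "f z"] that V area by simp
  have pull: "\<exists>a \<in> vertex_areas s t. \<delta> * a = \<bar>tri x y z\<bar>"
    if xyz: "x \<in> vertices s t'" "y \<in> vertices s t'" "z \<in> vertices s t'" for x y z
  proof -
    obtain x' y' z' where *: "x' \<in> vertices s t" "y' \<in> vertices s t" "z' \<in> vertices s t"
      "x = f x'" "y = f y'" "z = f z'" using xyz V by auto
    then show ?thesis using abs_tri_vertices[OF st(1) *(1-3)] area[of x' y' z'] by metis
  qed
  have \<delta>: "\<delta> \<le> 1" "\<delta> \<ge> 0"
    using vertex_areas_bounds(1)[OF st(2) push[OF in_V(1,2,5)]] by (auto simp: tri_vertices \<delta>_def)
  obtain a where a: "a \<in> vertex_areas s t" "\<delta> * a = 1"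
    using pull[OF in_V(1,2,5)] by (auto simp: tri_vertices)
  have "\<delta> * a \<le> \<delta> * 1" using vertex_areas_bounds(1)[OF st(1) a(1)] \<delta> by (intro mult_left_mono) auto
  then have one: "\<delta> = 1" using a \<delta> by simp
  have s: "s - 1 > 0" "s - 2 * t > 0" "s - 2 * t' > 0"
    using st by (auto simp: admissible_def)
  then have pos: "(s - 2 * t) * (s - 1) > 0" "(s - 2 * t') * (s - 1) > 0" by auto
  have "(s - 2 * t) * (s - 1) \<in> vertex_areas s t'"
    using push[OF in_V(2,3,4)] pos by (simp only: tri_vertices one abs_of_pos mult_1)
  then have 1: "(s - 2 * t') * (s - 1) \<le> (s - 2 * t) * (s - 1)"
    using vertex_areas_bounds(2)[OF st(2)] pos by fastforce
  have "(s - 2 * t') * (s - 1) \<in> vertex_areas s t"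
    using pull[OF in_V(2,3,4)] pos by (simp only: tri_vertices one abs_of_pos mult_1) blast
  then have 2: "(s - 2 * t) * (s - 1) \<le> (s - 2 * t') * (s - 1)"
    using vertex_areas_bounds(2)[OF st(1)] pos by fastforce
  from 2 1 have "(s - 2 * t) * (s - 1) = (s - 2 * t') * (s - 1)" by (rule antisym)
  then have "s - 2 * t = s - 2 * t'" using s(1) by (metis less_irrefl mult_right_cancel)
  then show "t = t'" by simp
qed

lemma pentagon_family:
  assumes r: "7 / 4 < r" "r < 2"
  defines "F \<equiv> pentagon (2 / r) ` {2 * (2 / r - 1) .. (2 / r) / 4}"
  shows "F \<approx> (UNIV :: real set)" "\<forall>K\<in>F. convex_pentagon K \<and> equidistant_to_symmetric K r"
    "pairwise (\<lambda>K K'. \<not> affinely_equivalent K K') F"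
proof -
  let ?I = "{2 * (2 / r - 1) .. (2 / r) / 4}"
  have adm: "admissible (2 / r) t" if "t \<in> ?I" for t
    using that r by (auto simp: admissible_def field_simps)
  have inj: "inj_on (pentagon (2 / r)) ?I"
  proof (rule inj_onI)
    fix t t' assume t: "t \<in> ?I" "t' \<in> ?I" "pentagon (2 / r) t = pentagon (2 / r) t'"
    have "affinely_equivalent (pentagon (2 / r) t) (pentagon (2 / r) t')"
      unfolding affinely_equivalent_def t(3)
      by (rule exI[of _ id], rule exI[of _ 0]) (simp add: linear_id)
    then show "t = t'" using affinely_equivalent_pentagons adm t by blast
  qed
  have "F \<approx> ?I" unfolding F_def by (rule inj_on_image_eqpoll_self[OF inj])
  moreover have "?I \<approx> (UNIV :: real set)"
    unfolding closed_interval_eqpoll_reals using r by (simp add: field_simps)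
  ultimately show "F \<approx> (UNIV :: real set)" by (rule eqpoll_trans)
  show "\<forall>K\<in>F. convex_pentagon K \<and> equidistant_to_symmetric K r"
  proof
    fix K assume "K \<in> F"
    then obtain t where t: "t \<in> ?I" "K = pentagon (2 / r) t" unfolding F_def by blast
    have "2 / r < 2" "2 / (2 / r) = r" using r by (auto simp: field_simps)
    then show "convex_pentagon K \<and> equidistant_to_symmetric K r"
      using convex_pentagon_pentagon pentagon_equidistant adm[OF t(1)] t(2) by metis
  qed
  show "pairwise (\<lambda>K K'. \<not> affinely_equivalent K K') F"
    unfolding pairwise_def F_def using affinely_equivalent_pentagons adm by blast
qed

lemma pentagon_exists:
  assumes r: "7 / 4 \<le> r" "r < 2"
  shows "\<exists>K. convex_pentagon K \<and> equidistant_to_symmetric K r"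
proof -
  have "admissible (2 / r) ((2 / r) / 4)" "2 / r < 2" "2 / (2 / r) = r"
    using r by (auto simp: admissible_def field_simps)
  then show ?thesis using convex_pentagon_pentagon pentagon_equidistant by metis
qed

section \<open>The square and the hexagon\<close>

text \<open>
  Two symmetric bodies with a large mutual distance. The hexagon is an affine image of the regular
  one, with vertices (1,0), (1,1), (0,1) and their negatives.
\<close>
definition square :: "(real^2) set" where
  "square = {p. \<bar>p $ 1\<bar> \<le> 1 \<and> \<bar>p $ 2\<bar> \<le> 1}"

definition hexagon :: "(real^2) set" where
  "hexagon = {p. \<bar>p $ 1\<bar> \<le> 1 \<and> \<bar>p $ 2\<bar> \<le> 1 \<and> \<bar>p $ 1 - p $ 2\<bar> \<le> 1}"

lemma symmetric_body:
  fixes L :: "(real^2) set"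
  assumes "closed L" "convex L" "\<And>p. p \<in> L \<Longrightarrow> - p \<in> L"
    "L \<subseteq> square" "\<And>p. \<bar>p $ 1\<bar> + \<bar>p $ 2\<bar> \<le> 1 \<Longrightarrow> p \<in> L"
  shows "convex_body L" "centrally_symmetric L"
proof -
  have "square \<subseteq> cbox (- 1) 1" by (auto simp: square_def mem_box_cart forall_2)
  then have "bounded L" using assms(4) bounded_cbox bounded_subset by blast
  moreover have "0 \<in> interior L"
  proof -
    have "p \<in> L" if "norm p \<le> 1 / 2" for p
      using component_le_norm_cart[of p 1] component_le_norm_cart[of p 2] that by (intro assms(5)) linarith
    then have "cball 0 (1 / 2) \<subseteq> L" by auto
    then show ?thesis unfolding mem_interior_cball by (intro exI[of _ "1 / 2"]) simp
  qed
  ultimately show "convex_body L"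
    unfolding convex_body_def using assms(1,2) by (auto simp: compact_eq_bounded_closed)
  have "(\<lambda>x. 2 *\<^sub>R 0 - x) ` L = L"
  proof
    show "(\<lambda>x. 2 *\<^sub>R 0 - x) ` L \<subseteq> L" using assms(3) by auto
    show "L \<subseteq> (\<lambda>x. 2 *\<^sub>R 0 - x) ` L"
    proof
      fix x assume "x \<in> L"
      then have "- x \<in> L" "x = 2 *\<^sub>R 0 - (- x)" using assms(3) by auto
      then show "x \<in> (\<lambda>x. 2 *\<^sub>R 0 - x) ` L" by blast
    qed
  qed
  then show "centrally_symmetric L" unfolding centrally_symmetric_def by blast
qed

lemma square_body: "convex_body square" "centrally_symmetric square"
proof -
  have eq: "square = cbox (- 1) 1" by (auto simp: square_def mem_box_cart forall_2 abs_le_iff)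
  have c: "closed square" "convex square" unfolding eq by (auto simp: closed_cbox)
  show "convex_body square" "centrally_symmetric square"
    by (rule symmetric_body[OF c]; auto simp: square_def)+
qed

lemma hexagon_body: "convex_body hexagon" "centrally_symmetric hexagon"
proof -
  have eq: "hexagon = cbox (- 1) 1 \<inter> {p. pt 1 (-1) \<bullet> p \<le> 1} \<inter> {p. pt (-1) 1 \<bullet> p \<le> 1}"
    by (auto simp: hexagon_def mem_box_cart forall_2 abs_le_iff inner_vec_def sum_2)
  have c: "closed hexagon" "convex hexagon" unfolding eq
    by (intro closed_Int closed_halfspace_le convex_Int convex_halfspace_le closed_cbox convex_box)+
  show "convex_body hexagon" "centrally_symmetric hexagon"
    by (rule symmetric_body[OF c]; auto simp: square_def hexagon_def)+
qed

text \<open>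
  The determinant bound in the critical case, where two vertices of the inscribed parallelogram lie on
  edges of the hexagon. For m < 3/2 the constraints s, t \<le> m - 1 and s + t \<ge> 2 - m force st to be at least
  its value at the end points of the feasible segment, and the resulting quadratic in m has roots
  4/3 and 3/2.
\<close>
lemma det_bound_normalized:
  fixes s t m :: real
  assumes "0 \<le> s" "0 \<le> t" "1 + s \<le> m" "1 + t \<le> m" "2 - s - t \<le> m"
  shows "1 - s * t \<le> 2 / 3 * m"
proof (cases "m \<ge> 3 / 2")
  case True
  then show ?thesis using mult_nonneg_nonneg[OF assms(1,2)] by linarith
next
  case False
  define a where "a = m - 1"
  have a: "s \<le> a" "t \<le> a" "1 - a \<le> s + t" "1 / 3 \<le> a" "a \<le> 1 / 2" using assms False by (auto simp: a_def)
  have "(a - s) * (a - t) \<ge> 0" using a by simp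
  moreover have "a * (1 - a) \<le> a * (s + t)" using a by (intro mult_left_mono) auto
  moreover have "(a - 1 / 3) * (1 / 2 - a) \<ge> 0" using a by simp
  ultimately have "1 / 3 - 2 / 3 * a \<le> s * t" by (simp add: algebra_simps)
  then show ?thesis unfolding a_def by argo
qed

text \<open>
  The general case follows from the normalized one with s/u, t/v and M/(uv): as u and v are at most 1, the
  three bounds on M survive the rescaling.
\<close>
lemma det_bound_pos:
  fixes s t u v M :: real
  assumes "0 \<le> s" "s \<le> u" "u \<le> 1" "0 \<le> t" "t \<le> v" "v \<le> 1"
    and M: "u + t \<le> M" "v + s \<le> M" "(u - s) + (v - t) \<le> M"
  shows "u * v - s * t \<le> 2 / 3 * M"
proof (cases "u = 0 \<or> v = 0")
  case True
  then show ?thesis using assms by auto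
next
  case False
  then have uv: "u > 0" "v > 0" using assms by auto
  have le: "x * y \<le> x" if "0 \<le> x" "y \<le> 1" for x y :: real using mult_left_mono[OF that(2,1)] by simp
  have d: "u * v > 0" using uv by simp
  have "1 - (s / u) * (t / v) \<le> 2 / 3 * (M / (u * v))"
  proof (rule det_bound_normalized)
    have "u * v + s * v \<le> v + s" using le[of v u] le[of s v] assms by (simp add: mult.commute)
    then show "1 + s / u \<le> M / (u * v)"
      unfolding pos_le_divide_eq[OF d] using uv M(2) by (simp add: distrib_right)
    have "u * v + t * u \<le> u + t" using le[of u v] le[of t u] assms by (simp add: mult.commute)
    then show "1 + t / v \<le> M / (u * v)"
      unfolding pos_le_divide_eq[OF d] using uv M(1) by (simp add: distrib_right)
    have "(u - s) * v + (v - t) * u \<le> (u - s) + (v - t)"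
      using le[of "u - s" v] le[of "v - t" u] assms by simp
    then show "2 - s / u - t / v \<le> M / (u * v)"
      unfolding pos_le_divide_eq[OF d] using uv M(3) by (simp add: left_diff_distrib)
  qed (use assms uv in auto)
  then have "(u * v) * (1 - (s / u) * (t / v)) \<le> (u * v) * (2 / 3 * (M / (u * v)))"
    using d by (intro mult_left_mono) auto
  then show ?thesis using uv by (simp add: algebra_simps)
qed

text \<open>
  Both products in the determinant have the same sign, so their difference is at most the larger of
  them, hence at most |a1 b1|, which is at most the mean of |a1| and |b1|.
\<close>
lemma det_bound_same_leading_index:
  fixes a1 a2 a3 b1 b2 b3 M :: real
  assumes "a1 + a2 + a3 = 0" "\<bar>a1\<bar> = \<bar>a2\<bar> + \<bar>a3\<bar>" "\<bar>a1\<bar> \<le> 1"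
    and "b1 + b2 + b3 = 0" "\<bar>b1\<bar> = \<bar>b2\<bar> + \<bar>b3\<bar>" "\<bar>b1\<bar> \<le> 1"
    and "\<bar>a1\<bar> + \<bar>b1\<bar> \<le> M"
  shows "\<bar>a1 * b2 - a2 * b1\<bar> \<le> 2 / 3 * M"
proof -
  have sgns: "a1 \<ge> 0 \<and> a2 \<le> 0 \<or> a1 \<le> 0 \<and> a2 \<ge> 0" "b1 \<ge> 0 \<and> b2 \<le> 0 \<or> b1 \<le> 0 \<and> b2 \<ge> 0"
    using assms by linarith+
  have same: "0 \<le> (a1 * b2) * (a2 * b1)"
  proof -
    have "a1 * a2 \<le> 0" "b1 * b2 \<le> 0" using sgns by (auto simp: mult_le_0_iff)
    then have "0 \<le> (a1 * a2) * (b1 * b2)" by (rule mult_nonpos_nonpos)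
    then show ?thesis by (simp add: mult_ac)
  qed
  have le: "\<bar>a1 * b2\<bar> \<le> \<bar>a1\<bar> * \<bar>b1\<bar>" "\<bar>a2 * b1\<bar> \<le> \<bar>a1\<bar> * \<bar>b1\<bar>"
    unfolding abs_mult using assms(2,5) by (auto intro!: mult_left_mono mult_right_mono)
  have "\<bar>x - y\<bar> \<le> c" if "0 \<le> x * y" "\<bar>x\<bar> \<le> c" "\<bar>y\<bar> \<le> c" for x y c :: real
  proof -
    have "0 \<le> x \<and> 0 \<le> y \<or> x \<le> 0 \<and> y \<le> 0" using that(1) unfolding zero_le_mult_iff .
    then show ?thesis using that(2,3) by linarith
  qed
  from this[OF same le] have "\<bar>a1 * b2 - a2 * b1\<bar> \<le> \<bar>a1\<bar> * \<bar>b1\<bar>" .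
  moreover have "\<bar>a1\<bar> * \<bar>b1\<bar> \<le> \<bar>a1\<bar>" "\<bar>a1\<bar> * \<bar>b1\<bar> \<le> \<bar>b1\<bar>"
    using mult_left_mono[OF assms(6), of "\<bar>a1\<bar>"] mult_right_mono[OF assms(3), of "\<bar>b1\<bar>"] by auto
  ultimately show ?thesis using assms(7) by linarith
qed

text \<open>
  Here the products again have the same sign, so the determinant is |a1||b2| - |a2||b1|.
\<close>
lemma det_bound_distinct_leading_indices:
  fixes a1 a2 a3 b1 b2 b3 M :: real
  assumes "a1 + a2 + a3 = 0" "\<bar>a1\<bar> = \<bar>a2\<bar> + \<bar>a3\<bar>" "\<bar>a1\<bar> \<le> 1"
    and "b1 + b2 + b3 = 0" "\<bar>b2\<bar> = \<bar>b1\<bar> + \<bar>b3\<bar>" "\<bar>b2\<bar> \<le> 1"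
    and M: "\<bar>a1\<bar> + \<bar>b1\<bar> \<le> M" "\<bar>a2\<bar> + \<bar>b2\<bar> \<le> M" "\<bar>a3\<bar> + \<bar>b3\<bar> \<le> M"
  shows "\<bar>a1 * b2 - a2 * b1\<bar> \<le> 2 / 3 * M"
proof -
  have e: "\<bar>a3\<bar> = \<bar>a1\<bar> - \<bar>a2\<bar>" "\<bar>b3\<bar> = \<bar>b2\<bar> - \<bar>b1\<bar>" "\<bar>a2\<bar> \<le> \<bar>a1\<bar>" "\<bar>b1\<bar> \<le> \<bar>b2\<bar>"
    using assms(2,5) by linarith+
  have D: "\<bar>a1\<bar> * \<bar>b2\<bar> - \<bar>a2\<bar> * \<bar>b1\<bar> \<le> 2 / 3 * M"
  proof (rule det_bound_pos)
    show "\<bar>a1\<bar> - \<bar>a2\<bar> + (\<bar>b2\<bar> - \<bar>b1\<bar>) \<le> M" using M(3) e by linarith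
  qed (use assms(3,6) M e(3,4) in linarith)+
  have sgns: "a1 \<ge> 0 \<and> a2 \<le> 0 \<or> a1 \<le> 0 \<and> a2 \<ge> 0" "b2 \<ge> 0 \<and> b1 \<le> 0 \<or> b2 \<le> 0 \<and> b1 \<ge> 0"
    using assms by linarith+
  have same: "0 \<le> (a1 * b2) * (a2 * b1)"
  proof -
    have "a1 * a2 \<le> 0" "b1 * b2 \<le> 0" using sgns by (auto simp: mult_le_0_iff)
    then have "0 \<le> (a1 * a2) * (b1 * b2)" by (rule mult_nonpos_nonpos)
    then show ?thesis by (simp add: mult_ac)
  qed
  have "\<bar>a2\<bar> * \<bar>b1\<bar> \<le> \<bar>a1\<bar> * \<bar>b2\<bar>" using e by (intro mult_mono) auto
  then have le: "\<bar>a2 * b1\<bar> \<le> \<bar>a1 * b2\<bar>" by (simp add: abs_mult)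
  have "\<bar>x - y\<bar> = \<bar>x\<bar> - \<bar>y\<bar>" if "0 \<le> x * y" "\<bar>y\<bar> \<le> \<bar>x\<bar>" for x y :: real
  proof -
    have "0 \<le> x \<and> 0 \<le> y \<or> x \<le> 0 \<and> y \<le> 0" using that(1) unfolding zero_le_mult_iff .
    then show ?thesis using that(2) by linarith
  qed
  from this[OF same le] show ?thesis using D by (simp add: abs_mult)
qed

text \<open>
  A point p of the hexagon is described by the three coordinates p$1, -p$2, p$2 - p$1, which have sum zero
  and absolute value at most 1; these are the linear functionals that bound the hexagon. In a
  zero-sum triple one entry equals in absolute value the sum of the other two. The two preceding lemmas
  treat a common and different positions of these leading entries, and all other cases
  arise by permuting the three coordinates.
\<close>
lemma det_bound:
  fixes a1 a2 a3 b1 b2 b3 M :: real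
  assumes a: "a1 + a2 + a3 = 0" "\<bar>a1\<bar> \<le> 1" "\<bar>a2\<bar> \<le> 1" "\<bar>a3\<bar> \<le> 1"
    and b: "b1 + b2 + b3 = 0" "\<bar>b1\<bar> \<le> 1" "\<bar>b2\<bar> \<le> 1" "\<bar>b3\<bar> \<le> 1"
    and M: "\<bar>a1\<bar> + \<bar>b1\<bar> \<le> M" "\<bar>a2\<bar> + \<bar>b2\<bar> \<le> M" "\<bar>a3\<bar> + \<bar>b3\<bar> \<le> M"
  shows "\<bar>a1 * b2 - a2 * b1\<bar> \<le> 2 / 3 * M"
proof -
  have a3: "a3 = - a1 - a2" and b3: "b3 = - b1 - b2" using a b by auto
  have "a2 * b3 - a3 * b2 = a1 * b2 - a2 * b1" "a3 * b1 - a1 * b3 = a1 * b2 - a2 * b1"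
    unfolding a3 b3 by (simp_all add: algebra_simps)
  then have D: "\<bar>a1 * b2 - a2 * b1\<bar> = \<bar>a2 * b3 - a3 * b2\<bar>" "\<bar>a1 * b2 - a2 * b1\<bar> = \<bar>a3 * b1 - a1 * b3\<bar>"
    "\<bar>a1 * b2 - a2 * b1\<bar> = \<bar>a2 * b1 - a1 * b2\<bar>" "\<bar>a1 * b2 - a2 * b1\<bar> = \<bar>a3 * b2 - a2 * b3\<bar>"
    "\<bar>a1 * b2 - a2 * b1\<bar> = \<bar>a1 * b3 - a3 * b1\<bar>"
    by (metis abs_minus_commute)+
  consider (A1) "\<bar>a1\<bar> = \<bar>a2\<bar> + \<bar>a3\<bar>" | (A2) "\<bar>a2\<bar> = \<bar>a1\<bar> + \<bar>a3\<bar>" | (A3) "\<bar>a3\<bar> = \<bar>a1\<bar> + \<bar>a2\<bar>"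
    using a(1) by linarith
  note A = this
  consider (B1) "\<bar>b1\<bar> = \<bar>b2\<bar> + \<bar>b3\<bar>" | (B2) "\<bar>b2\<bar> = \<bar>b1\<bar> + \<bar>b3\<bar>" | (B3) "\<bar>b3\<bar> = \<bar>b1\<bar> + \<bar>b2\<bar>"
    using b(1) by linarith
  note B = this
  show ?thesis
  proof (cases rule: A)
    case A1
    show ?thesis
    proof (cases rule: B)
      case B1 show ?thesis by (rule det_bound_same_leading_index[of a1 a2 a3 b1 b2 b3]) (use A1 B1 assms in linarith)+
    next
      case B2 show ?thesis by (rule det_bound_distinct_leading_indices[of a1 a2 a3 b1 b2 b3]) (use A1 B2 assms in linarith)+
    next
      case B3 show ?thesis unfolding D(5)
        by (rule det_bound_distinct_leading_indices[of a1 a3 a2 b1 b3 b2]) (use A1 B3 assms in linarith)+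
    qed
  next
    case A2
    show ?thesis
    proof (cases rule: B)
      case B1 show ?thesis unfolding D(3)
        by (rule det_bound_distinct_leading_indices[of a2 a1 a3 b2 b1 b3]) (use A2 B1 assms in linarith)+
    next
      case B2 show ?thesis unfolding D(3)
        by (rule det_bound_same_leading_index[of a2 a1 a3 b2 b1 b3]) (use A2 B2 assms in linarith)+
    next
      case B3 show ?thesis unfolding D(1)
        by (rule det_bound_distinct_leading_indices[of a2 a3 a1 b2 b3 b1]) (use A2 B3 assms in linarith)+
    qed
  next
    case A3
    show ?thesis
    proof (cases rule: B)
      case B1 show ?thesis unfolding D(2)
        by (rule det_bound_distinct_leading_indices[of a3 a1 a2 b3 b1 b2]) (use A3 B1 assms in linarith)+
    next
      case B2 show ?thesis unfolding D(4)
        by (rule det_bound_distinct_leading_indices[of a3 a2 a1 b3 b2 b1]) (use A3 B2 assms in linarith)+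
    next
      case B3 show ?thesis unfolding D(2)
        by (rule det_bound_same_leading_index[of a3 a1 a2 b3 b1 b2]) (use A3 B3 assms in linarith)+
    qed
  qed
qed

lemma linear_difference:
  fixes T T' :: "real^'n \<Rightarrow> real^'n"
  assumes T: "linear T" "linear T'" "bij T'"
  obtains R where "linear R" "\<And>x. T' (R x) = T x"
proof -
  define R where "R x = inv T' (T x)" for x
  have T'R: "T' (R x) = T x" for x unfolding R_def using T(3) by (simp add: bij_is_surj surj_f_inv_f)
  have inj: "x = y" if "T' x = T' y" for x y using that T(3) by (meson bij_is_inj injD)
  have "linear R"
    by (rule linearI; rule inj)
      (simp_all add: T'R linear_add[OF T(1)] linear_add[OF T(2)] linear_scale[OF T(1)] linear_scale[OF T(2)])
  then show ?thesis using that T'R by blast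
qed

text \<open>
  For symmetric convex sets a translation in an inclusion can be dropped: average the inclusion
  with its reflection.
\<close>
lemma symmetric_convex_average:
  fixes L M :: "'a::real_vector set"
  assumes R: "linear R" and M: "convex M" "\<And>x. x \<in> M \<Longrightarrow> - x \<in> M"
    and L: "\<And>x. x \<in> L \<Longrightarrow> - x \<in> L"
    and shift: "\<And>x. x \<in> L \<Longrightarrow> \<exists>y\<in>M. R x = a *\<^sub>R y + w" and x: "x \<in> L"
  shows "\<exists>y\<in>M. R x = a *\<^sub>R y"
proof -
  obtain y where y: "y \<in> M" "R x = a *\<^sub>R y + w" using shift x by blast
  obtain y' where y': "y' \<in> M" "R (- x) = a *\<^sub>R y' + w" using shift L x by blast
  have "(1 / 2) *\<^sub>R y + (1 / 2) *\<^sub>R (- y') \<in> M"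
    by (rule convexD[OF M(1) y(1) M(2)[OF y'(1)]]) auto
  moreover have "R x = a *\<^sub>R ((1 / 2) *\<^sub>R y + (1 / 2) *\<^sub>R (- y'))"
  proof -
    have "2 *\<^sub>R R x = R x - R (- x)" by (simp add: linear_neg[OF R] scaleR_2)
    also have "\<dots> = a *\<^sub>R (y - y')" unfolding y y' by (simp add: scaleR_diff_right)
    finally have "(1 / 2) *\<^sub>R 2 *\<^sub>R R x = (1 / 2) *\<^sub>R (a *\<^sub>R (y - y'))" by simp
    then show ?thesis by (simp add: scaleR_diff_right)
  qed
  ultimately show ?thesis by blast
qed

text \<open>
  The submultiplicativity of the Banach-Mazur distance: two sandwiches for the same K give a linear
  sandwich between L and M.
\<close>
lemma sandwich_factors_compose:
  fixes K L M :: "(real^'n) set"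
  assumes L: "convex L" "\<And>x. x \<in> L \<Longrightarrow> - x \<in> L" and M: "convex M" "\<And>x. x \<in> M \<Longrightarrow> - x \<in> M"
    and "sandwich_factor K L a" "sandwich_factor K M b"
  obtains R where "linear R" "\<And>x. x \<in> L \<Longrightarrow> \<exists>y\<in>M. R x = a *\<^sub>R y"
    "\<And>y. y \<in> M \<Longrightarrow> \<exists>x\<in>L. y = b *\<^sub>R R x"
proof -
  obtain T u v where T: "linear T" "bij T"
    and TL: "(\<lambda>x. x + u) ` K \<subseteq> T ` (\<lambda>x. x + v) ` L"
     "T ` (\<lambda>x. x + v) ` L \<subseteq> (\<lambda>x. a *\<^sub>R x) ` (\<lambda>x. x + u) ` K"
    using assms(5) unfolding sandwich_factor_def by blast
  obtain T' u' v' where T': "linear T'" "bij T'"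
    and TM: "(\<lambda>x. x + u') ` K \<subseteq> T' ` (\<lambda>x. x + v') ` M"
     "T' ` (\<lambda>x. x + v') ` M \<subseteq> (\<lambda>x. b *\<^sub>R x) ` (\<lambda>x. x + u') ` K"
    using assms(6) unfolding sandwich_factor_def by blast
  obtain R where R: "linear R" "\<And>x. T' (R x) = T x"
    using linear_difference[OF T(1) T'] by blast
  have inj: "x = y" if "T' x = T' y" for x y using that T'(2) by (meson bij_is_inj injD)
  obtain w where w: "T' w = a *\<^sub>R T' v' - a *\<^sub>R u' + a *\<^sub>R u - T v"
    using T'(2) by (metis bij_pointE)
  obtain z where z: "T' z = b *\<^sub>R T v - b *\<^sub>R u + b *\<^sub>R u' - T' v'"
    using T'(2) by (metis bij_pointE)
  have 1: "\<exists>y\<in>M. R x = a *\<^sub>R y + w" if x: "x \<in> L" for x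
  proof -
    obtain k where k: "k \<in> K" "T (x + v) = a *\<^sub>R (k + u)" using TL(2) x by blast
    obtain y where y: "y \<in> M" "k + u' = T' (y + v')" using TM(1) k(1) by blast
    have "T x = a *\<^sub>R (k + u) - T v" using k(2) by (simp add: linear_add[OF T(1)] algebra_simps)
    also have "k = T' (y + v') - u'" using y(2) by (simp add: algebra_simps)
    finally have "T' (R x) = T' (a *\<^sub>R y + w)"
      by (simp add: R(2) w linear_add[OF T'(1)] linear_scale[OF T'(1)] algebra_simps)
    then show ?thesis using inj y(1) by blast
  qed
  have 2: "\<exists>x\<in>L. id y = b *\<^sub>R R x + z" if y: "y \<in> M" for y
  proof -
    obtain k where k: "k \<in> K" "T' (y + v') = b *\<^sub>R (k + u')" using TM(2) y by blast
    obtain x where x: "x \<in> L" "k + u = T (x + v)" using TL(1) k(1) by blast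
    have "T' y = b *\<^sub>R (k + u') - T' v'" using k(2) by (simp add: linear_add[OF T'(1)] algebra_simps)
    also have "k = T (x + v) - u" using x(2) by (simp add: algebra_simps)
    finally have "T' y = T' (b *\<^sub>R R x + z)"
      by (simp add: R(2) z linear_add[OF T'(1)] linear_add[OF T(1)] linear_scale[OF T'(1)] algebra_simps)
    then show ?thesis using inj x(1) unfolding id_def by blast
  qed
  have RL: "convex (R ` L)" "\<And>x. x \<in> R ` L \<Longrightarrow> - x \<in> R ` L"
    using convex_linear_image[OF R(1) L(1)] L(2) by (auto simp: linear_neg[OF R(1), symmetric])
  have "\<exists>x\<in>R ` L. id y = b *\<^sub>R x" if "y \<in> M" for y
    by (rule symmetric_convex_average[OF linear_id RL M(2) _ that]) (use 2 in auto)
  moreover have "\<exists>y\<in>M. R x = a *\<^sub>R y" if "x \<in> L" for x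
    by (rule symmetric_convex_average[OF R(1) M L(2) 1 that])
  ultimately show ?thesis using that[OF R(1)] by auto
qed

text \<open>
  The vertices of the square become, up to the factor a, points p, q of the hexagon, and a point h
  lies in the parallelogram spanned by \<plusminus>p, \<plusminus>q scaled by ab exactly if
  |h \<times> q| + |p \<times> h| \<le> ab |p \<times> q|. Applied to three vertices h of the hexagon this bounds the sums
  of coordinates in the determinant bound by ab |p \<times> q|.
\<close>
lemma square_hexagon_factor:
  fixes K :: "(real^2) set"
  assumes S: "sandwich_factor K square a" and H: "sandwich_factor K hexagon b"
  shows "3 / 2 \<le> a * b"
proof -
  have ab: "a > 0" "b > 0" using S H by (auto simp: sandwich_factor_def)
  obtain R where R: "linear R" and SH: "\<And>x. x \<in> square \<Longrightarrow> \<exists>y\<in>hexagon. R x = a *\<^sub>R y"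
    and HS: "\<And>y. y \<in> hexagon \<Longrightarrow> \<exists>x\<in>square. y = b *\<^sub>R R x"
  proof (rule sandwich_factors_compose[OF _ _ _ _ S H])
    show "convex square" "convex hexagon" using square_body hexagon_body by (auto simp: convex_body_def)
  qed (auto simp: square_def hexagon_def)
  obtain p where p: "p \<in> hexagon" "R (pt 1 1) = a *\<^sub>R p" using SH[of "pt 1 1"] by (auto simp: square_def)
  obtain q where q: "q \<in> hexagon" "R (pt 1 (-1)) = a *\<^sub>R q" using SH[of "pt 1 (-1)"] by (auto simp: square_def)
  define D where "D = \<bar>cross p q\<bar>"
  have key: "\<bar>cross h q\<bar> + \<bar>cross p h\<bar> \<le> a * b * D" if h: "h \<in> hexagon" for h
  proof -
    obtain x where x: "x \<in> square" "h = b *\<^sub>R R x" using HS h by blast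
    define \<alpha> where "\<alpha> = (x $ 1 + x $ 2) / 2"
    define \<beta> where "\<beta> = (x $ 1 - x $ 2) / 2"
    have "x = \<alpha> *\<^sub>R pt 1 1 + \<beta> *\<^sub>R pt 1 (-1)"
      by (simp add: vec_eq_iff_2 \<alpha>_def \<beta>_def field_simps)
    then have "R x = \<alpha> *\<^sub>R (a *\<^sub>R p) + \<beta> *\<^sub>R (a *\<^sub>R q)"
      using p(2) q(2) by (simp only: linear_add[OF R] linear_scale[OF R])
    then have h: "h = (a * b * \<alpha>) *\<^sub>R p + (a * b * \<beta>) *\<^sub>R q"
      unfolding x(2) by (simp add: scaleR_add_right mult_ac)
    have "cross h q = a * b * \<alpha> * cross p q" "cross p h = a * b * \<beta> * cross p q"
      unfolding h by (simp_all add: cross_simps(1,2,5,6,7))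
    then have "\<bar>cross h q\<bar> + \<bar>cross p h\<bar> = (a * b * D) * (\<bar>\<alpha>\<bar> + \<bar>\<beta>\<bar>)"
      using ab by (simp add: abs_mult D_def algebra_simps)
    moreover have "\<bar>\<alpha>\<bar> + \<bar>\<beta>\<bar> \<le> 1"
    proof -
      have "\<bar>x $ 1\<bar> \<le> 1" "\<bar>x $ 2\<bar> \<le> 1" using x(1) by (auto simp: square_def)
      then have "\<bar>x $ 1 + x $ 2\<bar> + \<bar>x $ 1 - x $ 2\<bar> \<le> 2" by linarith
      then show ?thesis unfolding \<alpha>_def \<beta>_def abs_divide by simp
    qed
    ultimately show ?thesis using ab mult_left_mono[of "\<bar>\<alpha>\<bar> + \<bar>\<beta>\<bar>" 1 "a * b * D"] by (simp add: D_def)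
  qed
  have "pt 1 0 \<in> hexagon" "pt 0 1 \<in> hexagon" "pt 1 1 \<in> hexagon" by (auto simp: hexagon_def)
  note M = this[THEN key]
  have M1: "\<bar>p $ 2\<bar> + \<bar>q $ 2\<bar> \<le> a * b * D" "\<bar>p $ 1\<bar> + \<bar>q $ 1\<bar> \<le> a * b * D"
     "\<bar>p $ 2 - p $ 1\<bar> + \<bar>q $ 2 - q $ 1\<bar> \<le> a * b * D"
    using M by (auto simp: cross_def abs_minus_commute)
  have "\<bar>p $ 1 * (- q $ 2) - (- p $ 2) * q $ 1\<bar> \<le> 2 / 3 * (a * b * D)"
    by (rule det_bound[where ?a3.0 = "p $ 2 - p $ 1" and ?b3.0 = "q $ 2 - q $ 1"])
      (use p(1) q(1) M1 in \<open>auto simp: hexagon_def abs_minus_commute\<close>)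
  then have "D \<le> 2 / 3 * (a * b * D)" by (simp add: D_def cross_def abs_minus_commute)
  moreover have "D > 0"
  proof (rule ccontr)
    assume "\<not> D > 0"
    then have "D = 0" by (simp add: D_def)
    then have "p $ 1 = 0" "p $ 2 = 0" "q $ 1 = 0" "q $ 2 = 0" using M1(1,2) by auto
    then have "p = 0" "q = 0" by (auto simp: vec_eq_iff_2)
    then have Z: "R (pt 1 1) = 0" "R (pt 1 (-1)) = 0" using p q by auto
    obtain x where x: "pt 1 0 = b *\<^sub>R R x" using HS[of "pt 1 0"] by (auto simp: hexagon_def)
    have "x = ((x $ 1 + x $ 2) / 2) *\<^sub>R pt 1 1 + ((x $ 1 - x $ 2) / 2) *\<^sub>R pt 1 (-1)"
      by (simp add: vec_eq_iff_2 field_simps)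
    then have "R x = ((x $ 1 + x $ 2) / 2) *\<^sub>R R (pt 1 1) + ((x $ 1 - x $ 2) / 2) *\<^sub>R R (pt 1 (-1))"
      by (metis linear_add[OF R] linear_scale[OF R])
    then show False using x Z by (simp add: vec_eq_iff_2)
  qed
  ultimately have "1 * D \<le> (2 / 3 * (a * b)) * D" by simp
  then have "1 \<le> 2 / 3 * (a * b)" using \<open>D > 0\<close> by (simp only: mult_le_cancel_right_pos)
  then show ?thesis by simp
qed

text \<open>
  Both bodies contain a ball and are contained in another one. Without this the infimum defining the
  distance could be taken over the empty set.
\<close>
lemma sandwich_factor_exists:
  fixes K L :: "(real^'n) set"
  assumes "convex_body K" "convex_body L"
  shows "\<exists>r. sandwich_factor K L r"
proof -
  have balls: "\<exists>c e R. 0 < e \<and> 0 < R \<and> cball c e \<subseteq> C \<and> C \<subseteq> cball c R" if "convex_body C" for C :: "(real^'n) set"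
  proof -
    have C: "compact C" "interior C \<noteq> {}" using that by (auto simp: convex_body_def)
    obtain c where "c \<in> interior C" using C(2) by blast
    then obtain e where e: "e > 0" "cball c e \<subseteq> C" unfolding mem_interior_cball by blast
    obtain R where "\<forall>x\<in>C. dist c x \<le> R"
      using compact_imp_bounded[OF C(1)] unfolding bounded_any_center[of _ c] by blast
    then have "C \<subseteq> cball c (max R 1)" by (auto simp: le_max_iff_disj)
    then show ?thesis using e by (intro exI[of _ c] exI[of _ e] exI[of _ "max R 1"]) auto
  qed
  obtain k e R where K: "0 < e" "0 < R" "cball k e \<subseteq> K" "K \<subseteq> cball k R" using balls assms(1) by blast
  obtain l d S where L: "0 < d" "0 < S" "cball l d \<subseteq> L" "L \<subseteq> cball l S" using balls assms(2) by blast
  define c where "c = R / d"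
  have c: "c > 0" using K L by (simp add: c_def)
  define r where "r = c * S / e"
  have r: "r > 0" using K L c by (simp add: r_def)
  have "linear (\<lambda>x::real^'n. c *\<^sub>R x)" by (rule linear_scaleR)
  moreover have "bij (\<lambda>x::real^'n. c *\<^sub>R x)"
    by (rule o_bij[of "\<lambda>x. (1 / c) *\<^sub>R x"]) (use c in auto)
  moreover have "(\<lambda>x. x + (- k)) ` K \<subseteq> (\<lambda>x. c *\<^sub>R x) ` (\<lambda>x. x + (- l)) ` L"
  proof
    fix p assume "p \<in> (\<lambda>x. x + (- k)) ` K"
    then have "norm p \<le> R" using K(4) by (auto simp: dist_norm norm_minus_commute)
    then have "norm p / c \<le> d" using K L by (simp add: c_def field_simps)
    then have "l + (1 / c) *\<^sub>R p \<in> L" using L(3) c by (auto simp: dist_norm subset_iff)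
    moreover have "p = c *\<^sub>R ((l + (1 / c) *\<^sub>R p) + (- l))" using c by simp
    ultimately show "p \<in> (\<lambda>x. c *\<^sub>R x) ` (\<lambda>x. x + (- l)) ` L" by blast
  qed
  moreover have "(\<lambda>x. c *\<^sub>R x) ` (\<lambda>x. x + (- l)) ` L \<subseteq> (\<lambda>x. r *\<^sub>R x) ` (\<lambda>x. x + (- k)) ` K"
  proof
    fix p assume "p \<in> (\<lambda>x. c *\<^sub>R x) ` (\<lambda>x. x + (- l)) ` L"
    then have "norm p \<le> c * S" using L(4) c by (auto simp: dist_norm norm_minus_commute)
    then have "norm p / r \<le> e" using K L c by (simp add: r_def field_simps)
    then have "k + (1 / r) *\<^sub>R p \<in> K" using K(3) r by (auto simp: dist_norm subset_iff)
    moreover have "p = r *\<^sub>R ((k + (1 / r) *\<^sub>R p) + (- k))" using r by simp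
    ultimately show "p \<in> (\<lambda>x. r *\<^sub>R x) ` (\<lambda>x. x + (- k)) ` K" by blast
  qed
  ultimately show ?thesis unfolding sandwich_factor_def using r by blast
qed

lemma banach_mazur_approx:
  fixes K L :: "(real^'n) set"
  assumes "convex_body K" "convex_body L" "banach_mazur K L < x"
  obtains \<rho> where "sandwich_factor K L \<rho>" "banach_mazur K L \<le> \<rho>" "\<rho> < x"
proof -
  let ?A = "{r. sandwich_factor K L r}"
  have ne: "?A \<noteq> {}" using sandwich_factor_exists[OF assms(1,2)] by blast
  have bdd: "bdd_below ?A" by (rule bdd_belowI[of _ 0]) (auto simp: sandwich_factor_def)
  obtain \<rho> where "\<rho> \<in> ?A" "\<rho> < x" using cInf_lessD[OF ne] assms(3) by (auto simp: banach_mazur_eq)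
  moreover have "banach_mazur K L \<le> \<rho>" unfolding banach_mazur_eq using calculation bdd by (intro cInf_lower)
  ultimately show ?thesis using that by blast
qed

text \<open>
  If r were smaller, there would be sandwiches for the square and the hexagon whose ratios have a product
  below 3/2.
\<close>
lemma equidistant_lower_bound:
  assumes K: "convex_body K" "equidistant_to_symmetric K r"
  shows "sqrt (3 / 2) \<le> r"
proof (rule ccontr)
  assume "\<not> sqrt (3 / 2) \<le> r"
  then have "r < sqrt (3 / 2)" by simp
  moreover have r: "banach_mazur K square = r" "banach_mazur K hexagon = r"
    using K(2) square_body hexagon_body by (auto simp: equidistant_to_symmetric_def)
  ultimately obtain a b where a: "sandwich_factor K square a" "a < sqrt (3 / 2)"
    and b: "sandwich_factor K hexagon b" "b < sqrt (3 / 2)"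
    using banach_mazur_approx[OF K(1) square_body(1)] banach_mazur_approx[OF K(1) hexagon_body(1)] by metis
  have "a > 0" "b > 0" using a b by (auto simp: sandwich_factor_def)
  then have "a * b < sqrt (3 / 2) * sqrt (3 / 2)" using a b by (intro mult_strict_mono) auto
  then show False using square_hexagon_factor[OF a(1) b(1)] by simp
qed

section \<open>Optimal parallelograms\<close>

text \<open>
  The parallelogram with centre m and half-sides p and q contains K and lies in
  r K + b; the covectors f, g are the basis dual to p, q. Carrying both bases makes all conditions
  closed: the inner inclusion is stated with f, g, the outer one with p, q.
\<close>
definition parallelogram_sandwich ::
  "(real^2) set \<Rightarrow> real \<Rightarrow> real^2 \<Rightarrow> real^2 \<Rightarrow> real^2 \<Rightarrow> real^2 \<Rightarrow> real^2 \<Rightarrow> real^2 \<Rightarrow> bool" where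
  "parallelogram_sandwich K r f g p q m b \<longleftrightarrow>
     f \<bullet> p = 1 \<and> f \<bullet> q = 0 \<and> g \<bullet> p = 0 \<and> g \<bullet> q = 1 \<and>
     (\<forall>z. z = (f \<bullet> z) *\<^sub>R p + (g \<bullet> z) *\<^sub>R q) \<and>
     (\<forall>k\<in>K. \<bar>f \<bullet> (k - m)\<bar> \<le> 1 \<and> \<bar>g \<bullet> (k - m)\<bar> \<le> 1) \<and>
     (\<forall>\<alpha> \<beta>. \<bar>\<alpha>\<bar> \<le> 1 \<longrightarrow> \<bar>\<beta>\<bar> \<le> 1 \<longrightarrow> (1 / r) *\<^sub>R (m + \<alpha> *\<^sub>R p + \<beta> *\<^sub>R q - b) \<in> K)"

lemma parallelogram_sandwich_exists:
  assumes "sandwich_factor K square r"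
  shows "\<exists>f g p q m b. parallelogram_sandwich K r f g p q m b"
proof -
  obtain T u v where T: "linear T" "bij T" and r: "r > 0"
    and TS: "(\<lambda>x. x + u) ` K \<subseteq> T ` (\<lambda>x. x + v) ` square"
     "T ` (\<lambda>x. x + v) ` square \<subseteq> (\<lambda>x. r *\<^sub>R x) ` (\<lambda>x. x + u) ` K"
    using assms unfolding sandwich_factor_def by blast
  obtain R where R: "linear R" "\<And>x. T (R x) = id x"
    using linear_difference[OF linear_id T] by blast
  have inj: "x = y" if "T x = T y" for x y using that T(2) by (meson bij_is_inj injD)
  have RT: "R (T x) = x" for x by (rule inj) (simp add: R(2))
  define f where "f = adjoint R (pt 1 0)"
  define g where "g = adjoint R (pt 0 1)"
  define p where "p = T (pt 1 0)"
  define q where "q = T (pt 0 1)"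
  define m where "m = T v - u"
  define b where "b = (r - 1) *\<^sub>R u"
  have fg: "f \<bullet> z = R z $ 1" "g \<bullet> z = R z $ 2" for z
    using adjoint_works[OF R(1), of z] by (simp_all add: f_def g_def inner_commute inner_vec_def sum_2)
  have "z = (f \<bullet> z) *\<^sub>R p + (g \<bullet> z) *\<^sub>R q" for z
  proof -
    have "R z = (R z $ 1) *\<^sub>R pt 1 0 + (R z $ 2) *\<^sub>R pt 0 1" by (simp add: vec_eq_iff_2)
    then have "T (R z) = T ((R z $ 1) *\<^sub>R pt 1 0 + (R z $ 2) *\<^sub>R pt 0 1)" by simp
    then show ?thesis unfolding fg R(2) p_def q_def by (simp add: linear_add[OF T(1)] linear_scale[OF T(1)])
  qed
  moreover have "\<bar>f \<bullet> (k - m)\<bar> \<le> 1 \<and> \<bar>g \<bullet> (k - m)\<bar> \<le> 1" if k: "k \<in> K" for k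
  proof -
    obtain l where l: "l \<in> square" "k + u = T (l + v)" using TS(1) k by blast
    have "k - m = T l" using l(2) by (simp add: m_def linear_add[OF T(1)] algebra_simps)
    then have "R (k - m) = l" by (simp add: RT)
    then show ?thesis using l(1) by (simp add: fg square_def)
  qed
  moreover have "(1 / r) *\<^sub>R (m + \<alpha> *\<^sub>R p + \<beta> *\<^sub>R q - b) \<in> K" if ab: "\<bar>\<alpha>\<bar> \<le> 1" "\<bar>\<beta>\<bar> \<le> 1" for \<alpha> \<beta>
  proof -
    have "pt \<alpha> \<beta> \<in> square" using ab by (simp add: square_def)
    then obtain k where k: "k \<in> K" "T (pt \<alpha> \<beta> + v) = r *\<^sub>R (k + u)" using TS(2) by blast
    have "pt \<alpha> \<beta> = \<alpha> *\<^sub>R pt 1 0 + \<beta> *\<^sub>R pt 0 1" by (simp add: vec_eq_iff_2)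
    then have "T (pt \<alpha> \<beta>) = \<alpha> *\<^sub>R p + \<beta> *\<^sub>R q"
      by (simp add: p_def q_def linear_add[OF T(1)] linear_scale[OF T(1)])
    then have "m + \<alpha> *\<^sub>R p + \<beta> *\<^sub>R q = T (pt \<alpha> \<beta> + v) - u"
      by (simp add: m_def linear_add[OF T(1)])
    also have "\<dots> = r *\<^sub>R k + b" unfolding k(2) b_def by (simp add: algebra_simps)
    finally show ?thesis using k(1) r by simp
  qed
  ultimately have "parallelogram_sandwich K r f g p q m b"
    unfolding parallelogram_sandwich_def by (simp add: fg p_def q_def RT)
  then show ?thesis by blast
qed

text \<open>
  The covectors are bounded since they vary by at most 2 on a ball inside K; the half-sides p and q
  are bounded since the parallelogram lies in a homothet of K; the centre and b follow.
\<close>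
lemma parallelogram_sandwich_bounded:
  assumes K: "convex_body K"
  shows "\<exists>C. \<forall>r f g p q m b. 0 < r \<and> r \<le> R \<and> parallelogram_sandwich K r f g p q m b \<longrightarrow>
    norm f \<le> C \<and> norm g \<le> C \<and> norm p \<le> C \<and> norm q \<le> C \<and> norm m \<le> C \<and> norm b \<le> C"
proof -
  obtain k where "k \<in> interior K" using K by (auto simp: convex_body_def)
  then obtain e where e: "e > 0" "cball k e \<subseteq> K" unfolding mem_interior_cball by blast
  have kK: "k \<in> K" using e by auto
  obtain B where B: "\<forall>x\<in>K. norm x \<le> B" using K compact_imp_bounded bounded_iff unfolding convex_body_def by metis
  have B0: "0 \<le> B" using B kK norm_ge_zero order_trans by blast
  define C where "C = 2 / e + 3 * \<bar>R\<bar> * B + 2 * B"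
  have "norm f \<le> C \<and> norm g \<le> C \<and> norm p \<le> C \<and> norm q \<le> C \<and> norm m \<le> C \<and> norm b \<le> C"
    if r: "0 < r" "r \<le> R" and P: "parallelogram_sandwich K r f g p q m b" for r f g p q m b
  proof -
    note P = P[unfolded parallelogram_sandwich_def]
    have functional: "norm h \<le> 2 / e" if h: "\<forall>x\<in>K. \<bar>h \<bullet> (x - m)\<bar> \<le> 1" for h
    proof (cases "h = 0")
      case False
      define x where "x = k + (e / norm h) *\<^sub>R h"
      have "x \<in> K" using e False by (auto simp: x_def dist_norm subset_iff)
      then have "\<bar>h \<bullet> (x - m)\<bar> \<le> 1" "\<bar>h \<bullet> (k - m)\<bar> \<le> 1" using h kK by auto
      then have "\<bar>h \<bullet> (x - m) - h \<bullet> (k - m)\<bar> \<le> 2" by linarith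
      moreover have "h \<bullet> (x - m) - h \<bullet> (k - m) = e * norm h"
        using False by (simp add: x_def inner_diff_right inner_add_right dot_square_norm power2_eq_square)
      ultimately show ?thesis using e(1) by (simp add: field_simps)
    qed (use e in auto)
    have fg: "norm f \<le> 2 / e" "norm g \<le> 2 / e" using P by (auto intro: functional)
    have pt: "norm (m + \<alpha> *\<^sub>R p + \<beta> *\<^sub>R q - b) \<le> r * B" if "\<bar>\<alpha>\<bar> \<le> 1" "\<bar>\<beta>\<bar> \<le> 1" for \<alpha> \<beta>
    proof -
      define X where "X = m + \<alpha> *\<^sub>R p + \<beta> *\<^sub>R q - b"
      have "norm ((1 / r) *\<^sub>R X) \<le> B" unfolding X_def using P B that by blast
      then have "norm X \<le> r * B" using r(1) by (simp add: field_simps)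
      then show ?thesis unfolding X_def .
    qed
    have rB: "r * B \<le> \<bar>R\<bar> * B" using r B0 by (intro mult_right_mono) auto
    have "norm ((m + 1 *\<^sub>R p + 0 *\<^sub>R q - b) - (m + (- 1) *\<^sub>R p + 0 *\<^sub>R q - b)) \<le> r * B + r * B"
      by (intro order_trans[OF norm_triangle_ineq4] add_mono pt) auto
    also have "(m + 1 *\<^sub>R p + 0 *\<^sub>R q - b) - (m + (- 1) *\<^sub>R p + 0 *\<^sub>R q - b) = 2 *\<^sub>R p"
      by (simp add: scaleR_2)
    finally have "norm p \<le> r * B" by (simp add: mult.commute)
    then have p: "norm p \<le> \<bar>R\<bar> * B" using rB by linarith
    have "norm ((m + 0 *\<^sub>R p + 1 *\<^sub>R q - b) - (m + 0 *\<^sub>R p + (- 1) *\<^sub>R q - b)) \<le> r * B + r * B"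
      by (intro order_trans[OF norm_triangle_ineq4] add_mono pt) auto
    also have "(m + 0 *\<^sub>R p + 1 *\<^sub>R q - b) - (m + 0 *\<^sub>R p + (- 1) *\<^sub>R q - b) = 2 *\<^sub>R q"
      by (simp add: scaleR_2)
    finally have "norm q \<le> r * B" by (simp add: mult.commute)
    then have q: "norm q \<le> \<bar>R\<bar> * B" using rB by linarith
    define x where "x = f \<bullet> (k - m)"
    define y where "y = g \<bullet> (k - m)"
    have km: "k - m = x *\<^sub>R p + y *\<^sub>R q" using P unfolding x_def y_def by blast
    have xy: "\<bar>x\<bar> \<le> 1" "\<bar>y\<bar> \<le> 1" using P kK by (auto simp: x_def y_def)
    have "norm (k - m) \<le> \<bar>x\<bar> * norm p + \<bar>y\<bar> * norm q"
      unfolding km by (rule order_trans[OF norm_triangle_ineq]) simp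
    also have "\<dots> \<le> 1 * norm p + 1 * norm q" using xy by (intro add_mono mult_right_mono) auto
    finally have "norm (k - m) \<le> 2 * \<bar>R\<bar> * B" using p q by simp
    moreover have "norm m \<le> norm k + norm (k - m)" by (metis norm_minus_commute norm_triangle_sub)
    moreover have "norm k \<le> B" using B kK by blast
    ultimately have m: "norm m \<le> B + 2 * \<bar>R\<bar> * B" by linarith
    have "norm (m - b) \<le> r * B" using pt[of 0 0] by simp
    moreover have "norm b \<le> norm m + norm (m - b)" by (metis norm_minus_commute norm_triangle_sub)
    ultimately have b: "norm b \<le> B + 3 * \<bar>R\<bar> * B" using m rB by (simp add: algebra_simps)
    have "0 \<le> 2 / e" "0 \<le> \<bar>R\<bar> * B" using e B0 by auto
    moreover have "3 * \<bar>R\<bar> * B = 3 * (\<bar>R\<bar> * B)" "2 * \<bar>R\<bar> * B = 2 * (\<bar>R\<bar> * B)" by simp_all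
    ultimately show ?thesis using fg p q m b B0 unfolding C_def by (intro conjI) linarith+
  qed
  then show ?thesis by blast
qed

text \<open>
  The distance to the square is attained: parallelograms for ratios tending to r have a convergent
  subsequence by boundedness, and all conditions pass to the limit.
\<close>
lemma parallelogram_sandwich_limit:
  assumes K: "convex_body K" and r: "r > 0" "\<And>x. r < x \<Longrightarrow> \<exists>\<rho>. r \<le> \<rho> \<and> \<rho> < x \<and> sandwich_factor K square \<rho>"
  shows "\<exists>f g p q m b. parallelogram_sandwich K r f g p q m b"
proof -
  have "\<exists>\<rho> f g p q m b. r \<le> \<rho> \<and> \<rho> < r + 1 / real (Suc n) \<and> parallelogram_sandwich K \<rho> f g p q m b" for n
  proof -
    obtain \<rho> where "r \<le> \<rho>" "\<rho> < r + 1 / real (Suc n)" "sandwich_factor K square \<rho>"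
      using r(2)[of "r + 1 / real (Suc n)"] by auto
    then show ?thesis using parallelogram_sandwich_exists by meson
  qed
  then obtain \<rho> f g p q m b where \<rho>: "\<And>n. r \<le> \<rho> n" "\<And>n. \<rho> n < r + 1 / real (Suc n)"
    and P: "\<And>n. parallelogram_sandwich K (\<rho> n) (f n) (g n) (p n) (q n) (m n) (b n)"
    by metis
  have \<rho>1: "\<rho> n \<le> r + 1" for n
  proof -
    have "1 / real (Suc n) \<le> 1" by simp
    then show ?thesis using \<rho>(2)[of n] by linarith
  qed
  obtain C where C: "\<And>s f g p q m b. 0 < s \<and> s \<le> r + 1 \<and> parallelogram_sandwich K s f g p q m b \<longrightarrow>
    norm f \<le> C \<and> norm g \<le> C \<and> norm p \<le> C \<and> norm q \<le> C \<and> norm m \<le> C \<and> norm b \<le> C"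
    using parallelogram_sandwich_bounded[OF K, of "r + 1"] by blast
  define X where "X n = (f n, g n, p n, q n, m n, b n)" for n
  let ?B = "cball (0::real^2) C"
  have "range X \<subseteq> ?B \<times> ?B \<times> ?B \<times> ?B \<times> ?B \<times> ?B"
  proof
    fix x assume "x \<in> range X"
    then obtain n where x: "x = X n" by blast
    have "0 < \<rho> n" using \<rho>(1)[of n] r(1) by linarith
    then have "norm (f n) \<le> C \<and> norm (g n) \<le> C \<and> norm (p n) \<le> C \<and> norm (q n) \<le> C \<and>
        norm (m n) \<le> C \<and> norm (b n) \<le> C"
      using C P \<rho>1 by blast
    then show "x \<in> ?B \<times> ?B \<times> ?B \<times> ?B \<times> ?B \<times> ?B" by (simp add: x X_def)
  qed
  moreover have "bounded (?B \<times> ?B \<times> ?B \<times> ?B \<times> ?B \<times> ?B)"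
    by (intro bounded_Times bounded_cball)
  ultimately have "bounded (range X)" using bounded_subset by blast
  then obtain l \<sigma> where \<sigma>: "strict_mono (\<sigma> :: nat \<Rightarrow> nat)" and lim: "(X \<circ> \<sigma>) \<longlonglongrightarrow> l"
    using bounded_imp_convergent_subsequence by blast
  obtain f' g' p' q' m' b' where l: "l = (f', g', p', q', m', b')" by (cases l) auto
  note lims = lim[unfolded l, THEN tendsto_fst] lim[unfolded l, THEN tendsto_snd, THEN tendsto_fst]
    lim[unfolded l, THEN tendsto_snd, THEN tendsto_snd, THEN tendsto_fst]
    lim[unfolded l, THEN tendsto_snd, THEN tendsto_snd, THEN tendsto_snd, THEN tendsto_fst]
    lim[unfolded l, THEN tendsto_snd, THEN tendsto_snd, THEN tendsto_snd, THEN tendsto_snd, THEN tendsto_fst]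
    lim[unfolded l, THEN tendsto_snd, THEN tendsto_snd, THEN tendsto_snd, THEN tendsto_snd, THEN tendsto_snd]
  have lf: "(\<lambda>n. f (\<sigma> n)) \<longlonglongrightarrow> f'" and lg: "(\<lambda>n. g (\<sigma> n)) \<longlonglongrightarrow> g'"
    and lp: "(\<lambda>n. p (\<sigma> n)) \<longlonglongrightarrow> p'" and lq: "(\<lambda>n. q (\<sigma> n)) \<longlonglongrightarrow> q'"
    and lm: "(\<lambda>n. m (\<sigma> n)) \<longlonglongrightarrow> m'" and lb: "(\<lambda>n. b (\<sigma> n)) \<longlonglongrightarrow> b'"
    using lims by (simp_all add: X_def o_def)
  have l\<rho>: "(\<lambda>n. \<rho> (\<sigma> n)) \<longlonglongrightarrow> r"
  proof -
    have "\<rho> \<longlonglongrightarrow> r"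
    proof (rule tendsto_sandwich)
      show "\<forall>\<^sub>F n in sequentially. r \<le> \<rho> n" using \<rho>(1) by simp
      show "\<forall>\<^sub>F n in sequentially. \<rho> n \<le> r + 1 / real (Suc n)" using \<rho>(2) less_imp_le by (intro always_eventually) blast
      have "(\<lambda>n. r + 1 / real (Suc n)) \<longlonglongrightarrow> r + 0" by (intro tendsto_add tendsto_const lim_1_over_n LIMSEQ_Suc)
      then show "(\<lambda>n. r + 1 / real (Suc n)) \<longlonglongrightarrow> r" by simp
    qed simp
    then show ?thesis using LIMSEQ_subseq_LIMSEQ[OF _ \<sigma>] by (simp add: o_def)
  qed
  note P = P[unfolded parallelogram_sandwich_def]
  have "f' \<bullet> p' = 1" by (rule LIMSEQ_unique[OF tendsto_inner[OF lf lp]]) (use P in simp)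
  moreover have "f' \<bullet> q' = 0" by (rule LIMSEQ_unique[OF tendsto_inner[OF lf lq]]) (use P in simp)
  moreover have "g' \<bullet> p' = 0" by (rule LIMSEQ_unique[OF tendsto_inner[OF lg lp]]) (use P in simp)
  moreover have "g' \<bullet> q' = 1" by (rule LIMSEQ_unique[OF tendsto_inner[OF lg lq]]) (use P in simp)
  moreover have "z = (f' \<bullet> z) *\<^sub>R p' + (g' \<bullet> z) *\<^sub>R q'" for z
  proof -
    have "(\<lambda>n. (f (\<sigma> n) \<bullet> z) *\<^sub>R p (\<sigma> n) + (g (\<sigma> n) \<bullet> z) *\<^sub>R q (\<sigma> n))
        \<longlonglongrightarrow> (f' \<bullet> z) *\<^sub>R p' + (g' \<bullet> z) *\<^sub>R q'"
      by (intro tendsto_add tendsto_scaleR tendsto_inner tendsto_const lf lg lp lq)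
    moreover have "(\<lambda>n. (f (\<sigma> n) \<bullet> z) *\<^sub>R p (\<sigma> n) + (g (\<sigma> n) \<bullet> z) *\<^sub>R q (\<sigma> n)) = (\<lambda>n. z)"
      using P by metis
    ultimately show ?thesis using LIMSEQ_unique tendsto_const by metis
  qed
  moreover have "\<bar>f' \<bullet> (k - m')\<bar> \<le> 1 \<and> \<bar>g' \<bullet> (k - m')\<bar> \<le> 1" if k: "k \<in> K" for k
  proof -
    have "(\<lambda>n. \<bar>f (\<sigma> n) \<bullet> (k - m (\<sigma> n))\<bar>) \<longlonglongrightarrow> \<bar>f' \<bullet> (k - m')\<bar>"
      "(\<lambda>n. \<bar>g (\<sigma> n) \<bullet> (k - m (\<sigma> n))\<bar>) \<longlonglongrightarrow> \<bar>g' \<bullet> (k - m')\<bar>"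
      by (intro tendsto_rabs tendsto_inner tendsto_diff tendsto_const lf lg lm)+
    then show ?thesis using P k by (auto intro!: LIMSEQ_le_const2)
  qed
  moreover have "(1 / r) *\<^sub>R (m' + \<alpha> *\<^sub>R p' + \<beta> *\<^sub>R q' - b') \<in> K" if "\<bar>\<alpha>\<bar> \<le> 1" "\<bar>\<beta>\<bar> \<le> 1" for \<alpha> \<beta>
  proof (rule closed_sequentially)
    show "closed K" using K by (simp add: convex_body_def compact_imp_closed)
    show "(\<lambda>n. (1 / \<rho> (\<sigma> n)) *\<^sub>R (m (\<sigma> n) + \<alpha> *\<^sub>R p (\<sigma> n) + \<beta> *\<^sub>R q (\<sigma> n) - b (\<sigma> n)))
        \<longlonglongrightarrow> (1 / r) *\<^sub>R (m' + \<alpha> *\<^sub>R p' + \<beta> *\<^sub>R q' - b')"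
      by (intro tendsto_intros lm lp lq lb l\<rho>) (use r in simp)
    show "\<And>n. (1 / \<rho> (\<sigma> n)) *\<^sub>R (m (\<sigma> n) + \<alpha> *\<^sub>R p (\<sigma> n) + \<beta> *\<^sub>R q (\<sigma> n) - b (\<sigma> n)) \<in> K"
      using P that by blast
  qed
  ultimately have "parallelogram_sandwich K r f' g' p' q' m' b'"
    unfolding parallelogram_sandwich_def by blast
  then show ?thesis by blast
qed

section \<open>Smooth and strictly convex bodies\<close>

lemma frontier_by_functional:
  fixes K :: "'a::euclidean_space set"
  assumes "p \<in> K" "a \<noteq> 0" "\<And>k. k \<in> K \<Longrightarrow> a \<bullet> k \<le> a \<bullet> p"
  shows "p \<in> frontier K"
proof -
  have "interior K \<subseteq> interior {x. a \<bullet> x \<le> a \<bullet> p}" using assms(3) by (intro interior_mono) auto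
  then have "p \<notin> interior K" using assms(2) by (auto simp: interior_halfspace_le)
  then show ?thesis using assms(1) closure_subset by (auto simp: frontier_def)
qed

lemma strictly_convex_bodyD:
  fixes K :: "(real^2) set"
  assumes "strictly_convex_body K" "convex K" "x \<in> K" "y \<in> K" "a \<noteq> 0" "a \<bullet> x = c" "a \<bullet> y = c"
    "\<And>k. k \<in> K \<Longrightarrow> a \<bullet> k \<le> c"
  shows "x = y"
proof (rule ccontr)
  assume "x \<noteq> y"
  have "closed_segment x y \<subseteq> frontier K"
  proof
    fix z assume z: "z \<in> closed_segment x y"
    then have "z \<in> K" using assms(2-4) by (meson convex_contains_segment subsetD)
    moreover have "a \<bullet> z = c"
    proof -
      obtain u where "z = (1 - u) *\<^sub>R x + u *\<^sub>R y" using z by (auto simp: closed_segment_def)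
      then have "a \<bullet> z = (1 - u) * c + u * c" using assms(6,7) by (simp add: inner_add_right)
      then show ?thesis by (simp add: algebra_simps)
    qed
    ultimately show "z \<in> frontier K" using assms(5,8) by (intro frontier_by_functional) auto
  qed
  then show False using assms(1) \<open>x \<noteq> y\<close> unfolding strictly_convex_body_def by blast
qed

lemma smooth_bodyD:
  fixes K :: "(real^2) set"
  assumes "smooth_body K" "x \<in> K" "a \<noteq> 0" "c \<noteq> 0"
    "\<And>k. k \<in> K \<Longrightarrow> a \<bullet> k \<le> a \<bullet> x" "\<And>k. k \<in> K \<Longrightarrow> c \<bullet> k \<le> c \<bullet> x" "a \<bullet> d = 0"
  shows "c \<bullet> d = 0"
proof -
  have "x \<in> frontier K" using assms(2,3,5) by (rule frontier_by_functional)
  moreover have "supporting_line_at K x {y. a \<bullet> y = a \<bullet> x}" "supporting_line_at K x {y. c \<bullet> y = c \<bullet> x}"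
    unfolding supporting_line_at_def using assms(3-6) by blast+
  ultimately have "{y. a \<bullet> y = a \<bullet> x} = {y. c \<bullet> y = c \<bullet> x}"
    using assms(1) unfolding smooth_body_def by blast
  moreover have "x + d \<in> {y. a \<bullet> y = a \<bullet> x}" using assms(7) by (simp add: inner_add_right)
  ultimately have "x + d \<in> {y. c \<bullet> y = c \<bullet> x}" by blast
  then show ?thesis by (simp add: inner_add_right)
qed

text \<open>
  If x + \<epsilon> t is interior to M then so is every x + \<epsilon>' t with 0 < \<epsilon>' \<le> \<epsilon>, as x lies in the
  convex set M. Together with openness of the interior this lets compactness of K produce a common \<epsilon>.
\<close>
lemma push_into_interior_uniform:
  fixes K M :: "'a::euclidean_space set"
  assumes K: "compact K" "K \<subseteq> M" and M: "convex M"
    and push: "\<And>x. x \<in> K \<Longrightarrow> \<exists>\<epsilon>>0. x + \<epsilon> *\<^sub>R t \<in> interior M"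
  shows "\<exists>\<epsilon>>0. \<forall>x\<in>K. x + \<epsilon> *\<^sub>R t \<in> interior M"
proof (rule ccontr)
  assume no: "\<not> ?thesis"
  have "\<forall>n. \<exists>x\<in>K. x + (1 / real (Suc n)) *\<^sub>R t \<notin> interior M"
  proof
    fix n show "\<exists>x\<in>K. x + (1 / real (Suc n)) *\<^sub>R t \<notin> interior M"
      using no by (metis divide_pos_pos of_nat_0_less_iff zero_less_Suc zero_less_one)
  qed
  then obtain x where x: "\<And>n. x n \<in> K" "\<And>n. x n + (1 / real (Suc n)) *\<^sub>R t \<notin> interior M" by metis
  obtain l \<sigma> where l: "l \<in> K" and \<sigma>: "strict_mono (\<sigma> :: nat \<Rightarrow> nat)" and lim: "(x \<circ> \<sigma>) \<longlonglongrightarrow> l"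
    using K(1) x(1) unfolding compact_def by blast
  obtain \<epsilon> where \<epsilon>: "\<epsilon> > 0" "l + \<epsilon> *\<^sub>R t \<in> interior M" using push l by blast
  have "(\<lambda>n. (x \<circ> \<sigma>) n + \<epsilon> *\<^sub>R t) \<longlonglongrightarrow> l + \<epsilon> *\<^sub>R t" by (intro tendsto_add lim tendsto_const)
  then have "\<forall>\<^sub>F n in sequentially. (x \<circ> \<sigma>) n + \<epsilon> *\<^sub>R t \<in> interior M"
    using \<epsilon>(2) open_interior by (metis topological_tendstoD)
  moreover have "\<forall>\<^sub>F n in sequentially. 1 / real (Suc (\<sigma> n)) < \<epsilon>"
  proof -
    have "(\<lambda>n. 1 / real (Suc n)) \<longlonglongrightarrow> 0" by (intro lim_1_over_n LIMSEQ_Suc)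
    then have "((\<lambda>n. 1 / real (Suc n)) \<circ> \<sigma>) \<longlonglongrightarrow> 0" using \<sigma> by (rule LIMSEQ_subseq_LIMSEQ)
    then show ?thesis using \<epsilon>(1) by (auto simp: o_def dest: order_tendstoD(2))
  qed
  ultimately have "\<forall>\<^sub>F n in sequentially. False"
  proof eventually_elim
    case (elim n)
    let ?x = "x (\<sigma> n)" and ?e = "1 / real (Suc (\<sigma> n))"
    have in_M: "?x \<in> M" "?x + \<epsilon> *\<^sub>R t \<in> interior M" using elim(1) x(1) K(2) by auto
    have "?x - (?e / \<epsilon>) *\<^sub>R (?x - (?x + \<epsilon> *\<^sub>R t)) \<in> interior M"
      by (rule mem_interior_convex_shrink[OF M in_M(2,1)]) (use elim(2) \<epsilon>(1) in \<open>auto simp: field_simps\<close>)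
    moreover have "?x - (?e / \<epsilon>) *\<^sub>R (?x - (?x + \<epsilon> *\<^sub>R t)) = ?x + ?e *\<^sub>R t" using \<epsilon>(1) by simp
    ultimately have "?x + ?e *\<^sub>R t \<in> interior M" by (simp only:)
    then show False using x(2) by blast
  qed
  then show False by simp
qed

text \<open>
  A compact subset of the interior of M stays in M when it is dilated by a factor slightly larger
  than 1; equivalently, it lies in a slightly smaller homothet of M.
\<close>
lemma reflection_shrinks:
  fixes K :: "(real^'n) set"
  assumes K: "compact K" and r: "r > 0"
    and push: "\<And>x. x \<in> K \<Longrightarrow> x + t \<in> interior ((\<lambda>k. c - r *\<^sub>R k) ` K)"
  shows "\<exists>\<rho> w. 0 < \<rho> \<and> \<rho> < r \<and> reflects_into K \<rho> w"
proof -
  let ?M = "(\<lambda>k. c - r *\<^sub>R k) ` K"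
  define X where "X = (\<lambda>x. x + t) ` K"
  have X: "compact X" unfolding X_def
    using K by (intro compact_continuous_image continuous_intros)
  have XM: "X \<subseteq> interior ?M" unfolding X_def using push by blast
  obtain \<delta> where \<delta>: "\<delta> > 0" "\<And>x y. x \<in> X \<Longrightarrow> dist x y \<le> \<delta> \<Longrightarrow> y \<in> ?M"
  proof -
    have "X \<inter> - interior ?M = {}" using XM by blast
    moreover have "closed (- interior ?M)" by (simp only: closed_Compl open_interior)
    ultimately obtain d where d: "d > 0" "\<And>x y. x \<in> X \<Longrightarrow> y \<in> - interior ?M \<Longrightarrow> d \<le> dist x y"
      using separate_compact_closed[OF X, of "- interior ?M"] by blast
    have "y \<in> ?M" if xy: "x \<in> X" "dist x y \<le> d / 2" for x y
    proof (rule ccontr)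
      assume "y \<notin> ?M"
      then have "y \<in> - interior ?M" using interior_subset[of ?M] by blast
      then have "d \<le> dist x y" by (rule d(2)[OF xy(1)])
      then show False using xy(2) d(1) by linarith
    qed
    then show ?thesis using that[of "d / 2"] d(1) by simp
  qed
  obtain B where B: "B > 0" "\<And>x. x \<in> X \<Longrightarrow> norm x \<le> B"
    using compact_imp_bounded[OF X] bounded_pos by metis
  define \<mu> where "\<mu> = B / (B + \<delta>)"
  have \<mu>: "0 < \<mu>" "\<mu> < 1" "(1 / \<mu> - 1) * B = \<delta>" using B(1) \<delta>(1) by (auto simp: \<mu>_def field_simps)
  have "\<exists>k\<in>K. x + (\<mu> * r) *\<^sub>R k = \<mu> *\<^sub>R c - t" if x: "x \<in> K" for x
  proof -
    have "dist (x + t) ((1 / \<mu>) *\<^sub>R (x + t)) = norm ((1 / \<mu> - 1) *\<^sub>R (x + t))"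
      by (simp add: dist_norm norm_minus_commute scaleR_diff_left)
    also have "\<dots> = (1 / \<mu> - 1) * norm (x + t)" using \<mu> by simp
    also have "\<dots> \<le> (1 / \<mu> - 1) * B" using B(2)[of "x + t"] x \<mu> by (intro mult_left_mono) (auto simp: X_def)
    finally have "(1 / \<mu>) *\<^sub>R (x + t) \<in> ?M" using \<delta>(2)[of "x + t"] x \<mu>(3) by (simp add: X_def)
    then obtain k where k: "k \<in> K" "(1 / \<mu>) *\<^sub>R (x + t) = c - r *\<^sub>R k" by blast
    have "x + t = \<mu> *\<^sub>R ((1 / \<mu>) *\<^sub>R (x + t))" using \<mu>(1) by simp
    also have "\<dots> = \<mu> *\<^sub>R c - (\<mu> * r) *\<^sub>R k" unfolding k(2) by (simp add: scaleR_diff_right)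
    finally have "x + (\<mu> * r) *\<^sub>R k = \<mu> *\<^sub>R c - t" by (simp add: eq_diff_eq ac_simps)
    then show ?thesis using k(1) by blast
  qed
  then have "reflects_into K (\<mu> * r) (\<mu> *\<^sub>R c - t)" unfolding reflects_into_def by blast
  moreover have "0 < \<mu> * r" "\<mu> * r < r" using \<mu> r by auto
  ultimately show ?thesis by blast
qed

lemma interior_small_step:
  fixes x :: "'a::real_normed_vector"
  assumes "x \<in> interior M"
  shows "\<exists>\<epsilon>>0. x + \<epsilon> *\<^sub>R t \<in> interior M"
proof -
  obtain e where e: "e > 0" "ball x e \<subseteq> interior M"
    using assms open_contains_ball open_interior by blast
  define \<epsilon> where "\<epsilon> = e / (1 + norm t)"
  have t: "1 + norm t > 0" by (simp add: add_pos_nonneg)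
  have "norm (\<epsilon> *\<^sub>R t) < e" using e(1) t by (simp add: \<epsilon>_def field_simps)
  then have "x + \<epsilon> *\<^sub>R t \<in> interior M" using e(2) by (auto simp: dist_norm subset_iff)
  moreover have "\<epsilon> > 0" using e(1) t by (simp add: \<epsilon>_def)
  ultimately show ?thesis by blast
qed

text \<open>
  Given the optimal parallelogram L between K and r K + b, reflection in its centre m maps the outer
  body to M = c - r K. The coordinates x and y are those with respect to m, p, q, so that L is the set
  where both are at most 1 in absolute value. The points of K outside the interior of M are the contact
  points; the aim is to show that they can all be moved into the interior of M at once.
\<close>
locale parallelogram_position =
  fixes K :: "(real^2) set" and r :: real and f g p q m b :: "real^2"
  assumes K: "convex_body K" and r: "r > 1" and P: "parallelogram_sandwich K r f g p q m b"
begin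

definition c :: "real^2" where "c = 2 *\<^sub>R m - b"

definition M :: "(real^2) set" where "M = (\<lambda>k. c - r *\<^sub>R k) ` K"

definition x :: "real^2 \<Rightarrow> real" where "x z = f \<bullet> (z - m)"

definition y :: "real^2 \<Rightarrow> real" where "y z = g \<bullet> (z - m)"

lemma dual: "f \<bullet> p = 1" "f \<bullet> q = 0" "g \<bullet> p = 0" "g \<bullet> q = 1" "f \<noteq> 0" "g \<noteq> 0"
  using P unfolding parallelogram_sandwich_def by auto

lemma rep: "z = (f \<bullet> z) *\<^sub>R p + (g \<bullet> z) *\<^sub>R q"
  using P unfolding parallelogram_sandwich_def by blast

lemma K_in_L: "k \<in> K \<Longrightarrow> \<bar>x k\<bar> \<le> 1" "k \<in> K \<Longrightarrow> \<bar>y k\<bar> \<le> 1"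
  using P unfolding parallelogram_sandwich_def x_def y_def by blast+

text \<open>
  The two coordinates play the same role, so each statement about x yields one about y.
\<close>
lemma swap: "parallelogram_position K r g f q p m b"
proof
  have "(1 / r) *\<^sub>R (m + \<alpha> *\<^sub>R q + \<beta> *\<^sub>R p - b) \<in> K" if "\<bar>\<alpha>\<bar> \<le> 1" "\<bar>\<beta>\<bar> \<le> 1" for \<alpha> \<beta>
  proof -
    have "(1 / r) *\<^sub>R (m + \<beta> *\<^sub>R p + \<alpha> *\<^sub>R q - b) \<in> K"
      using P that unfolding parallelogram_sandwich_def by blast
    then show ?thesis by (simp only: add.assoc add.commute[of "\<alpha> *\<^sub>R q"])
  qed
  moreover have "z = (g \<bullet> z) *\<^sub>R q + (f \<bullet> z) *\<^sub>R p" for z using rep[of z] by (simp only: add.commute)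
  ultimately show "parallelogram_sandwich K r g f q p m b"
    using P unfolding parallelogram_sandwich_def by blast
qed (use K r in auto)

lemma coordinates: "z = m + x z *\<^sub>R p + y z *\<^sub>R q"
  using rep[of "z - m"] by (simp add: x_def y_def algebra_simps)

lemma coordinates_eqI: "x z = x w \<Longrightarrow> y z = y w \<Longrightarrow> z = w"
  using coordinates[of z] coordinates[of w] by simp

lemma coordinate_step: "x (z + w) = x z + f \<bullet> w" "y (z + w) = y z + g \<bullet> w"
  by (simp_all add: x_def y_def inner_diff_right inner_add_right)

lemma L_in_M:
  assumes "\<bar>x z\<bar> \<le> 1" "\<bar>y z\<bar> \<le> 1"
  shows "z \<in> M"
proof -
  have "\<bar>- x z\<bar> \<le> 1" "\<bar>- y z\<bar> \<le> 1" using assms by simp_all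
  then have "(1 / r) *\<^sub>R (m + (- x z) *\<^sub>R p + (- y z) *\<^sub>R q - b) \<in> K"
    using P unfolding parallelogram_sandwich_def by blast
  moreover have "z = c - r *\<^sub>R ((1 / r) *\<^sub>R (m + (- x z) *\<^sub>R p + (- y z) *\<^sub>R q - b))"
  proof -
    have "r *\<^sub>R ((1 / r) *\<^sub>R (m + (- x z) *\<^sub>R p + (- y z) *\<^sub>R q - b)) =
        m + (- x z) *\<^sub>R p + (- y z) *\<^sub>R q - b" using r by simp
    then have "c - r *\<^sub>R ((1 / r) *\<^sub>R (m + (- x z) *\<^sub>R p + (- y z) *\<^sub>R q - b)) =
        m + x z *\<^sub>R p + y z *\<^sub>R q" by (simp add: c_def scaleR_2)
    then show ?thesis using coordinates[of z] by simp
  qed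
  ultimately show ?thesis unfolding M_def by blast
qed

lemma interior_L_in_interior_M:
  assumes "\<bar>x z\<bar> < 1" "\<bar>y z\<bar> < 1"
  shows "z \<in> interior M"
proof (rule interiorI)
  show "open {z. \<bar>x z\<bar> < 1 \<and> \<bar>y z\<bar> < 1}"
    unfolding x_def y_def by (intro open_Collect_conj open_Collect_less continuous_intros)
  show "{z. \<bar>x z\<bar> < 1 \<and> \<bar>y z\<bar> < 1} \<subseteq> M" using L_in_M by auto
qed (use assms in simp)

lemma K_in_M: "K \<subseteq> M"
  using K_in_L L_in_M by blast

lemma convex_M: "convex M"
proof -
  have "M = (+) c ` (\<lambda>k. (- r) *\<^sub>R k) ` K" unfolding M_def by (auto simp: image_image)
  moreover have "convex K" using K by (simp add: convex_body_def)
  ultimately show ?thesis by (simp only: convex_translation convex_scaling)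
qed

lemma M_memI: "k \<in> K \<Longrightarrow> c - r *\<^sub>R k \<in> M"
  unfolding M_def by (rule imageI)

text \<open>
  At a contact point k inside an edge of L, the body M does not cross the line of this edge: if z in M
  did, then k would lie strictly between z and an interior point w of L, hence be interior to M.
\<close>
lemma edge_supports:
  assumes k: "k \<notin> interior M" "\<bar>x k\<bar> = 1" "\<bar>y k\<bar> < 1" and z: "z \<in> M"
  shows "x k * x z \<le> 1"
proof (rule ccontr)
  assume no: "\<not> x k * x z \<le> 1"
  define d where "d = 1 - \<bar>y k\<bar>"
  define N where "N = 1 + \<bar>y k - y z\<bar> + (x k * x z - 1)"
  \<comment> \<open>A step so small that w is still an interior point of L.\<close>
  define \<tau> where "\<tau> = d / (2 * N)"
  have N: "N > 0" "\<bar>y k - y z\<bar> \<le> N" "x k * x z - 1 \<le> N" using no by (auto simp: N_def)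
  have d: "0 < d" "d \<le> 1" using k(3) by (auto simp: d_def)
  have \<tau>: "0 < \<tau>" "\<tau> * N = d / 2" using d N by (auto simp: \<tau>_def)
  define w where "w = k + \<tau> *\<^sub>R (k - z)"
  have fw: "f \<bullet> (k - z) = x k - x z" "g \<bullet> (k - z) = y k - y z"
    by (simp_all add: x_def y_def inner_diff_right)
  have "x k * x w = 1 - \<tau> * (x k * x z - 1)"
  proof -
    have "x k * x k = 1" using k(2) by (metis abs_mult_self_eq mult_1)
    moreover have "x w = x k + \<tau> * (x k - x z)" unfolding w_def coordinate_step by (simp add: fw)
    then have "x k * x w = x k * x k + \<tau> * (x k * x k - x k * x z)" by (simp only: distrib_left right_diff_distrib mult_ac)
    ultimately show ?thesis by (simp add: algebra_simps)
  qed
  moreover have "\<tau> * (x k * x z - 1) \<le> d / 2" using mult_left_mono[OF N(3), of \<tau>] \<tau> by simp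
  moreover have "\<tau> * (x k * x z - 1) > 0" using \<tau> no by simp
  ultimately have "\<bar>x k * x w\<bar> < 1" using d by linarith
  then have xw: "\<bar>x w\<bar> < 1" using k(2) by (simp add: abs_mult)
  have "2 * \<bar>\<tau> * (y k - y z)\<bar> \<le> d"
    using mult_left_mono[OF N(2), of \<tau>] \<tau> by (simp add: abs_mult)
  moreover have "y w = y k + \<tau> * (y k - y z)" unfolding w_def coordinate_step by (simp add: fw)
  moreover have "\<bar>u + e\<bar> < 1" if "2 * \<bar>e\<bar> \<le> 1 - \<bar>u\<bar>" "0 < 1 - \<bar>u\<bar>" for u e :: real
    using that by linarith
  ultimately have "\<bar>y w\<bar> < 1" using d(1) unfolding d_def by simp
  then have "w \<in> interior M" using interior_L_in_interior_M xw by blast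
  then have "z - (1 / (1 + \<tau>)) *\<^sub>R (z - w) \<in> interior M"
    using \<tau> by (intro mem_interior_convex_shrink[OF convex_M _ z]) auto
  moreover have "z - (1 / (1 + \<tau>)) *\<^sub>R (z - w) = k"
  proof -
    have "z - w = (1 + \<tau>) *\<^sub>R (z - k)" by (simp add: w_def algebra_simps)
    then show ?thesis using \<tau>(1) by simp
  qed
  ultimately show False using k(1) by simp
qed

text \<open>
  Otherwise M lies in the strip between two opposite edges of L, which has width 2, while the points
  c - r k and c - r k' of M have distance 2r in that direction.
\<close>
lemma no_opposite_contacts:
  assumes "k \<in> K" "k \<notin> interior M" "x k = 1" "\<bar>y k\<bar> < 1"
    "k' \<in> K" "k' \<notin> interior M" "x k' = - 1" "\<bar>y k'\<bar> < 1"
  shows False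
proof -
  have "x (c - r *\<^sub>R k') \<le> 1" using edge_supports[of k, OF assms(2)] assms M_memI by fastforce
  moreover have "- 1 \<le> x (c - r *\<^sub>R k)" using edge_supports[of k', OF assms(6)] assms M_memI by fastforce
  moreover have "x (c - r *\<^sub>R k') - x (c - r *\<^sub>R k) = r * (x k - x k')"
    by (simp add: x_def inner_diff_right algebra_simps)
  ultimately show False using r assms by simp
qed

text \<open>
  At a vertex of L both f and g give a supporting line.
\<close>
lemma smooth_no_vertex:
  assumes "smooth_body K" "k \<in> K"
  shows "\<not> (\<bar>x k\<bar> = 1 \<and> \<bar>y k\<bar> = 1)"
proof
  assume v: "\<bar>x k\<bar> = 1 \<and> \<bar>y k\<bar> = 1"
  have le: "(h \<bullet> (k - m)) * (h \<bullet> l) \<le> (h \<bullet> (k - m)) * (h \<bullet> k)"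
    if "\<bar>h \<bullet> (k - m)\<bar> = 1" "\<bar>h \<bullet> (l - m)\<bar> \<le> 1" for h l :: "real^2"
  proof -
    have "(h \<bullet> (k - m)) * (h \<bullet> (l - m)) \<le> (h \<bullet> (k - m)) * (h \<bullet> (k - m))"
      using that by (cases "h \<bullet> (k - m) = 1") (auto simp: abs_if split: if_splits)
    then show ?thesis by (simp add: inner_diff_right algebra_simps)
  qed
  have "(y k *\<^sub>R g) \<bullet> q = 0"
  proof (rule smooth_bodyD[OF assms])
    show "x k *\<^sub>R f \<noteq> 0" "y k *\<^sub>R g \<noteq> 0" "(x k *\<^sub>R f) \<bullet> q = 0" using v dual by auto
    show "(x k *\<^sub>R f) \<bullet> l \<le> (x k *\<^sub>R f) \<bullet> k" "(y k *\<^sub>R g) \<bullet> l \<le> (y k *\<^sub>R g) \<bullet> k" if "l \<in> K" for l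
      using le[of f l] le[of g l] v K_in_L[OF that] by (auto simp: x_def y_def)
  qed
  then show False using v dual by auto
qed

text \<open>
  The number \<open>\<tau>\<close> is the direction along p that leads inward from every contact point on an edge parallel
  to q.
\<close>
lemma smooth_inward:
  assumes smooth: "smooth_body K"
  shows "\<exists>\<tau>. \<bar>\<tau>\<bar> = 1 \<and> (\<forall>k\<in>K. k \<notin> interior M \<longrightarrow> \<bar>x k\<bar> = 1 \<longrightarrow> \<bar>y k\<bar> < 1 \<and> x k = - \<tau>)"
proof -
  have y: "\<bar>y k\<bar> < 1" if "k \<in> K" "\<bar>x k\<bar> = 1" for k
    using smooth_no_vertex[OF smooth that(1)] K_in_L(2)[OF that(1)] that(2) by linarith
  show ?thesis
  proof (cases "\<exists>k\<in>K. k \<notin> interior M \<and> x k = 1")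
    case True
    then obtain k where k: "k \<in> K" "k \<notin> interior M" "x k = 1" by blast
    have "x l = 1" if l: "l \<in> K" "l \<notin> interior M" "\<bar>x l\<bar> = 1" for l
    proof (rule ccontr)
      assume "x l \<noteq> 1"
      then have "x l = - 1" using l(3) by linarith
      then show False using no_opposite_contacts k l y by (metis abs_one)
    qed
    then show ?thesis using y by (intro exI[of _ "-1"]) auto
  next
    case False
    then have "x l = - 1" if l: "l \<in> K" "l \<notin> interior M" "\<bar>x l\<bar> = 1" for l
      using l by (auto simp: abs_if split: if_splits)
    then show ?thesis using y by (intro exI[of _ 1]) auto
  qed
qed

text \<open>
  A contact point inside an edge forces M to have a boundary segment along this edge, and the
  corresponding homothetic segment lies in the boundary of K.
\<close>
lemma strict_contact_vertex:
  assumes strict: "strictly_convex_body K" and k: "k \<in> K" "k \<notin> interior M" "\<bar>x k\<bar> = 1"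
  shows "\<bar>y k\<bar> = 1"
proof (rule ccontr)
  assume "\<bar>y k\<bar> \<noteq> 1"
  then have yk: "\<bar>y k\<bar> < 1" using K_in_L(2)[OF k(1)] by simp
  define \<delta> where "\<delta> = 1 - \<bar>y k\<bar>"
  have \<delta>: "\<delta> > 0" using yk by (simp add: \<delta>_def)
  have xx: "x k * x k = 1" using k(3) by (metis abs_mult_self_eq mult_1)
  have "k + \<delta> *\<^sub>R q \<in> M" "k + 0 *\<^sub>R q \<in> M"
    by (rule L_in_M; use k(3) yk dual in \<open>auto simp: coordinate_step \<delta>_def\<close>)+
  then obtain u v where u: "u \<in> K" "k + \<delta> *\<^sub>R q = c - r *\<^sub>R u" and v: "v \<in> K" "k + 0 *\<^sub>R q = c - r *\<^sub>R v"
    unfolding M_def by blast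
  \<comment> \<open>The maximum over K of the functional obtained by transporting the edge line from M to K.\<close>
  define C where "C = 1 - x k * x c"
  have val: "(- (r * x k) *\<^sub>R f) \<bullet> l = x k * x (c - r *\<^sub>R l) - x k * x c" for l
    by (simp add: x_def inner_diff_right algebra_simps)
  have "u = v"
  proof (rule strictly_convex_bodyD[OF strict _ u(1) v(1)])
    show "convex K" using K by (simp add: convex_body_def)
    show "- (r * x k) *\<^sub>R f \<noteq> 0" using r k(3) dual by auto
    show "(- (r * x k) *\<^sub>R f) \<bullet> u = C" "(- (r * x k) *\<^sub>R f) \<bullet> v = C"
      unfolding val u(2)[symmetric] v(2)[symmetric] C_def by (simp_all add: coordinate_step dual xx)
    show "(- (r * x k) *\<^sub>R f) \<bullet> l \<le> C" if "l \<in> K" for l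
      unfolding val C_def using edge_supports[OF k(2,3) yk M_memI[OF that]] by simp
  qed
  then have "\<delta> *\<^sub>R q = 0" using u(2) v(2) by simp
  then show False using \<delta> dual by auto
qed

text \<open>
  Two vertices of L on a common edge would put this edge into the boundary of K.
\<close>
lemma strict_vertices_differ:
  assumes strict: "strictly_convex_body K" and k: "k \<in> K" "k' \<in> K" "\<bar>x k\<bar> = 1" "x k' = x k"
  shows "k' = k"
proof (rule strictly_convex_bodyD[OF strict _ k(2,1)])
  have xx: "x k * x k = 1" using k(3) by (metis abs_mult_self_eq mult_1)
  have val: "(x k *\<^sub>R f) \<bullet> l = x k * x l + x k * (f \<bullet> m)" for l
    by (simp add: x_def inner_diff_right algebra_simps)
  show "convex K" using K by (simp add: convex_body_def)
  show "x k *\<^sub>R f \<noteq> 0" using k(3) dual by auto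
  show "(x k *\<^sub>R f) \<bullet> k = 1 + x k * (f \<bullet> m)" "(x k *\<^sub>R f) \<bullet> k' = 1 + x k * (f \<bullet> m)"
    unfolding val k(4) xx by simp_all
  fix l assume "l \<in> K"
  then have "x k * x l \<le> \<bar>x k\<bar> * \<bar>x l\<bar>" "\<bar>x l\<bar> \<le> 1" using K_in_L by (auto simp flip: abs_mult)
  then show "(x k *\<^sub>R f) \<bullet> l \<le> 1 + x k * (f \<bullet> m)" unfolding val using k(3) by simp
qed

text \<open>
  If no translation moves v and v' into the interior of M simultaneously, separate the two translates
  of the interior. In the direction a of the separation M is then no wider than the
  pair v, v', whereas M contains c - r v and c - r v', which are r times as far apart. As r > 1,
  M would lie in a line.
\<close>
lemma common_inward_translation:
  assumes v: "v \<in> K" "v' \<in> K"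
  shows "\<exists>t. v + t \<in> interior M \<and> v' + t \<in> interior M"
proof (rule ccontr)
  assume no: "\<not> ?thesis"
  let ?A = "(\<lambda>z. z - v) ` interior M" and ?B = "(\<lambda>z. z - v') ` interior M"
  have m: "m \<in> interior M" by (rule interior_L_in_interior_M) (simp_all add: x_def y_def)
  have "?A \<inter> ?B = {}"
  proof (rule ccontr)
    assume "?A \<inter> ?B \<noteq> {}"
    then obtain z z' where z: "z \<in> interior M" "z' \<in> interior M" "z - v = z' - v'" by blast
    have "v + (z - v) = z" "v' + (z' - v') = z'" by simp_all
    then have "v + (z - v) \<in> interior M" "v' + (z - v) \<in> interior M" using z by metis+
    then show False using no by blast
  qed
  moreover have "convex ?A" "convex ?B"
    using convex_interior[OF convex_M] by (simp_all add: convex_translation_subtract)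
  moreover have "?A \<noteq> {}" "?B \<noteq> {}" using m by blast+
  ultimately obtain a \<beta> where a: "a \<noteq> 0" "\<forall>x\<in>?A. a \<bullet> x \<le> \<beta>" "\<forall>x\<in>?B. \<beta> \<le> a \<bullet> x"
    using separating_hyperplane_sets[of ?A ?B] by blast
  have cl: "M \<subseteq> closure (interior M)"
    using convex_closure_interior[OF convex_M] m closure_subset by blast
  have "interior M \<subseteq> {z. a \<bullet> z \<le> \<beta> + a \<bullet> v}" "interior M \<subseteq> {z. a \<bullet> z \<ge> \<beta> + a \<bullet> v'}"
    using a(2,3) by (auto simp: inner_diff_right algebra_simps)
  from closure_minimal[OF this(1) closed_halfspace_le] closure_minimal[OF this(2) closed_halfspace_ge]
  have "closure (interior M) \<subseteq> {z. a \<bullet> z \<le> \<beta> + a \<bullet> v}" "closure (interior M) \<subseteq> {z. a \<bullet> z \<ge> \<beta> + a \<bullet> v'}" .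
  then have M: "a \<bullet> z \<le> \<beta> + a \<bullet> v" "\<beta> + a \<bullet> v' \<le> a \<bullet> z" if "z \<in> M" for z using cl that by auto
  have "a \<bullet> (c - r *\<^sub>R v') \<le> \<beta> + a \<bullet> v" "\<beta> + a \<bullet> v' \<le> a \<bullet> (c - r *\<^sub>R v)"
    using M M_memI v by blast+
  then have "(r - 1) * (a \<bullet> v - a \<bullet> v') \<le> 0" by (simp add: inner_diff_right algebra_simps)
  then have av: "a \<bullet> v \<le> a \<bullet> v'" using r by (simp add: mult_le_0_iff)
  have const: "a \<bullet> z = a \<bullet> z'" if "z \<in> M" "z' \<in> M" for z z'
    using M[OF that(1)] M[OF that(2)] av by linarith
  have "m \<in> M" "m + p \<in> M" "m + q \<in> M"
    by (rule L_in_M; simp add: x_def y_def inner_add_right dual)+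
  then have "a \<bullet> p = 0" "a \<bullet> q = 0" using const[of "m + p" m] const[of "m + q" m] by (simp_all add: inner_add_right)
  then have "a \<bullet> a = 0" by (subst (2) rep[of a]) (simp add: inner_add_right)
  then show False using a(1) by simp
qed

lemma contact_on_boundary:
  assumes "k \<in> K" "k \<notin> interior M"
  shows "\<bar>x k\<bar> = 1 \<or> \<bar>y k\<bar> = 1"
proof (rule ccontr)
  assume "\<not> ?thesis"
  then have "\<bar>x k\<bar> < 1" "\<bar>y k\<bar> < 1" using K_in_L[OF assms(1)] by linarith+
  then show False using interior_L_in_interior_M assms(2) by blast
qed

lemma not_optimal:
  assumes "\<And>k. k \<in> K \<Longrightarrow> k \<notin> interior M \<Longrightarrow> \<exists>\<epsilon>>0. k + \<epsilon> *\<^sub>R t \<in> interior M"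
  shows "\<exists>\<rho> w. 0 < \<rho> \<and> \<rho> < r \<and> reflects_into K \<rho> w"
proof -
  have "compact K" using K by (simp add: convex_body_def)
  have "\<exists>\<epsilon>>0. \<forall>k\<in>K. k + \<epsilon> *\<^sub>R t \<in> interior M"
  proof (rule push_into_interior_uniform[OF \<open>compact K\<close> K_in_M convex_M])
    show "\<exists>\<epsilon>>0. k + \<epsilon> *\<^sub>R t \<in> interior M" if "k \<in> K" for k
      using assms[OF that] interior_small_step[of k M t] by blast
  qed
  then obtain \<epsilon> where "\<And>k. k \<in> K \<Longrightarrow> k + \<epsilon> *\<^sub>R t \<in> interior M" by blast
  then show ?thesis unfolding M_def
    by (intro reflection_shrinks[OF \<open>compact K\<close>]) (use r in auto)
qed

lemma swap_coordinates: "parallelogram_position.x g m = y" "parallelogram_position.y f m = x"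
  by (simp_all add: fun_eq_iff parallelogram_position.x_def[OF swap] parallelogram_position.y_def[OF swap] x_def y_def)

lemmas smooth_inward_swap = parallelogram_position.smooth_inward[OF swap, unfolded swap_coordinates]

lemmas strict_contact_vertex_swap = parallelogram_position.strict_contact_vertex[OF swap, unfolded swap_coordinates]

lemmas strict_vertices_differ_swap = parallelogram_position.strict_vertices_differ[OF swap, unfolded swap_coordinates]

lemma smooth_not_optimal:
  assumes smooth: "smooth_body K"
  shows "\<exists>\<rho> w. 0 < \<rho> \<and> \<rho> < r \<and> reflects_into K \<rho> w"
proof -
  obtain \<tau> where \<tau>: "\<bar>\<tau>\<bar> = 1" "\<And>k. k \<in> K \<Longrightarrow> k \<notin> interior M \<Longrightarrow> \<bar>x k\<bar> = 1 \<Longrightarrow> \<bar>y k\<bar> < 1 \<and> x k = - \<tau>"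
  proof -
    from smooth_inward[OF smooth] obtain \<tau> where
      *: "\<bar>\<tau>\<bar> = 1 \<and> (\<forall>k\<in>K. k \<notin> interior M \<longrightarrow> \<bar>x k\<bar> = 1 \<longrightarrow> \<bar>y k\<bar> < 1 \<and> x k = - \<tau>)" ..
    show ?thesis by (rule that[OF conjunct1[OF *] conjunct2[OF *, rule_format]])
  qed
  obtain \<upsilon> where \<upsilon>: "\<bar>\<upsilon>\<bar> = 1" "\<And>k. k \<in> K \<Longrightarrow> k \<notin> interior M \<Longrightarrow> \<bar>y k\<bar> = 1 \<Longrightarrow> \<bar>x k\<bar> < 1 \<and> y k = - \<upsilon>"
  proof -
    from smooth_inward_swap[OF smooth] obtain \<tau> where
      *: "\<bar>\<tau>\<bar> = 1 \<and> (\<forall>k\<in>K. k \<notin> interior M \<longrightarrow> \<bar>y k\<bar> = 1 \<longrightarrow> \<bar>x k\<bar> < 1 \<and> y k = - \<tau>)" ..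
    show ?thesis by (rule that[OF conjunct1[OF *] conjunct2[OF *, rule_format]])
  qed
  define t where "t = \<tau> *\<^sub>R p + \<upsilon> *\<^sub>R q"
  have step: "x (k + \<epsilon> *\<^sub>R t) = x k + \<epsilon> * \<tau>" "y (k + \<epsilon> *\<^sub>R t) = y k + \<epsilon> * \<upsilon>" for k \<epsilon>
    unfolding coordinate_step by (simp_all add: t_def inner_add_right dual)
  have move: "\<bar>a + \<epsilon> * s\<bar> < 1" if "\<bar>a\<bar> < 1" "\<epsilon> = (1 - \<bar>a\<bar>) / 2" "\<bar>s\<bar> = 1" for a s \<epsilon> :: real
  proof -
    have "2 * \<bar>\<epsilon> * s\<bar> = 1 - \<bar>a\<bar>" using that by (simp add: abs_mult)
    then show ?thesis using that(1) by linarith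
  qed
  have turn: "\<bar>- s + \<epsilon> * s\<bar> < 1" if "0 < \<epsilon>" "\<epsilon> \<le> 1 / 2" "\<bar>s\<bar> = 1" for s \<epsilon> :: real
  proof -
    have "s = 1 \<or> s = - 1" using that(3) by linarith
    then show ?thesis using that(1,2) by auto
  qed
  show ?thesis
  proof (rule not_optimal[of t])
    fix k assume k: "k \<in> K" "k \<notin> interior M"
    from contact_on_boundary[OF k] show "\<exists>\<epsilon>>0. k + \<epsilon> *\<^sub>R t \<in> interior M"
    proof
      assume "\<bar>x k\<bar> = 1"
      then have *: "\<bar>y k\<bar> < 1" "x k = - \<tau>" using \<tau>(2)[OF k] by simp_all
      define \<epsilon> where "\<epsilon> = (1 - \<bar>y k\<bar>) / 2"
      have \<epsilon>: "0 < \<epsilon>" "\<epsilon> \<le> 1 / 2" using * by (auto simp: \<epsilon>_def)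
      have "k + \<epsilon> *\<^sub>R t \<in> interior M"
        by (rule interior_L_in_interior_M)
          (use move[OF *(1) \<epsilon>_def \<upsilon>(1)] turn[OF \<epsilon> \<tau>(1)] *(2) in \<open>simp_all only: step\<close>)
      then show ?thesis using \<epsilon> by blast
    next
      assume "\<bar>y k\<bar> = 1"
      then have *: "\<bar>x k\<bar> < 1" "y k = - \<upsilon>" using \<upsilon>(2)[OF k] by simp_all
      define \<epsilon> where "\<epsilon> = (1 - \<bar>x k\<bar>) / 2"
      have \<epsilon>: "0 < \<epsilon>" "\<epsilon> \<le> 1 / 2" using * by (auto simp: \<epsilon>_def)
      have "k + \<epsilon> *\<^sub>R t \<in> interior M"
        by (rule interior_L_in_interior_M)
          (use move[OF *(1) \<epsilon>_def \<tau>(1)] turn[OF \<epsilon> \<upsilon>(1)] *(2) in \<open>simp_all only: step\<close>)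
      then show ?thesis using \<epsilon> by blast
    qed
  qed
qed

text \<open>
  The contact points are vertices of L, no two of them adjacent: there are none, or just one, or two
  opposite ones.
\<close>
lemma strictly_convex_not_optimal:
  assumes strict: "strictly_convex_body K"
  shows "\<exists>\<rho> w. 0 < \<rho> \<and> \<rho> < r \<and> reflects_into K \<rho> w"
proof -
  have vertex: "\<bar>x k\<bar> = 1" "\<bar>y k\<bar> = 1" if "k \<in> K" "k \<notin> interior M" for k
    using contact_on_boundary[OF that] strict_contact_vertex[OF strict that]
      strict_contact_vertex_swap[OF strict that] by blast+
  show ?thesis
  proof (cases "\<exists>v\<in>K. v \<notin> interior M")
    case False
    then show ?thesis using not_optimal by blast
  next
    case True
    then obtain v where v: "v \<in> K" "v \<notin> interior M" by blast
    define v' where "v' = 2 *\<^sub>R m - v"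
    have xv': "x v' = - x v" "y v' = - y v"
      by (simp_all add: v'_def x_def y_def inner_diff_right)
    have two: "k = v \<or> k = v'" if k: "k \<in> K" "k \<notin> interior M" for k
    proof (cases "x k = x v \<or> y k = y v")
      case True
      then show ?thesis
        using strict_vertices_differ[OF strict v(1) k(1) vertex(1)[OF v]]
          strict_vertices_differ_swap[OF strict v(1) k(1) vertex(2)[OF v]] by blast
    next
      case False
      then have "x k = - x v" "y k = - y v" using vertex[OF v] vertex[OF k] by linarith+
      then show ?thesis using coordinates_eqI xv' by simp
    qed
    have m: "m \<in> interior M" by (rule interior_L_in_interior_M) (simp_all add: x_def y_def)
    obtain t where t: "v + t \<in> interior M" "v' \<in> K \<and> v' \<notin> interior M \<longrightarrow> v' + t \<in> interior M"
    proof (cases "v' \<in> K")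
      case True
      then show ?thesis using common_inward_translation v(1) that by blast
    next
      case False
      then show ?thesis using that[of "m - v"] m by simp
    qed
    show ?thesis
    proof (rule not_optimal[of t])
      fix k assume k: "k \<in> K" "k \<notin> interior M"
      then have "k + 1 *\<^sub>R t \<in> interior M" using two[OF k] t by auto
      then show "\<exists>\<epsilon>>0. k + \<epsilon> *\<^sub>R t \<in> interior M" by (intro exI[of _ 1]) simp
    qed
  qed
qed

end

text \<open>
  In an optimal parallelogram for K, a smooth or strictly convex K would reflect into itself with a
  ratio below its asymmetry.
\<close>
lemma equidistant_not_regular:
  assumes K: "convex_body K" and equi: "equidistant_to_symmetric K r"
  shows "\<not> smooth_body K \<and> \<not> strictly_convex_body K"
proof -
  have "sqrt (3 / 2) \<le> r" using equidistant_lower_bound K equi by blast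
  moreover have "sqrt (3 / 2) > 1" by simp
  ultimately have r1: "r > 1" by linarith
  have bm: "banach_mazur K square = r" using equi square_body by (auto simp: equidistant_to_symmetric_def)
  have "\<exists>f g p q m b. parallelogram_sandwich K r f g p q m b"
  proof (rule parallelogram_sandwich_limit[OF K])
    fix x assume "r < x"
    then obtain \<rho> where "sandwich_factor K square \<rho>" "banach_mazur K square \<le> \<rho>" "\<rho> < x"
      using banach_mazur_approx[OF K square_body(1), of x] bm by blast
    then show "\<exists>\<rho>. r \<le> \<rho> \<and> \<rho> < x \<and> sandwich_factor K square \<rho>" using bm by blast
  qed (use r1 in simp)
  then obtain f g p q m b where "parallelogram_sandwich K r f g p q m b" by blast
  then interpret parallelogram_position K r f g p q m b using K r1 by unfold_locales
  have "r \<le> \<rho>" if "0 < \<rho>" "reflects_into K \<rho> w" for \<rho> w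
  proof -
    have "Inf {r. r > 0 \<and> (\<exists>w. reflects_into K r w)} \<le> \<rho>"
      using that by (intro cInf_lower bdd_belowI[of _ 0]) auto
    moreover have "asymmetry K = Inf {r. r > 0 \<and> (\<exists>w. reflects_into K r w)}"
      using K by (intro asymmetry_eq) (auto simp: convex_body_def)
    ultimately show ?thesis using equi by (simp add: equidistant_to_symmetric_def)
  qed
  then show ?thesis using smooth_not_optimal strictly_convex_not_optimal by (meson not_le)
qed

theorem theorem4p3:
  shows "(\<forall>r::real. 7 / 4 \<le> r \<and> r < 2 \<longrightarrow>
           (\<exists>K. convex_pentagon K \<and> equidistant_to_symmetric K r))
       \<and> (\<forall>r::real. 7 / 4 < r \<and> r < 2 \<longrightarrow>
           (\<exists>F :: (real^2) set set. F \<approx> (UNIV :: real set)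
              \<and> (\<forall>K\<in>F. convex_pentagon K \<and> equidistant_to_symmetric K r)
              \<and> pairwise (\<lambda>K K'. \<not> affinely_equivalent K K') F))
       \<and> (\<forall>(K :: (real^2) set) (r::real). convex_body K \<and> equidistant_to_symmetric K r \<longrightarrow>
           r \<ge> sqrt (3 / 2) \<and> \<not> smooth_body K \<and> \<not> strictly_convex_body K)"
  using pentagon_exists pentagon_family equidistant_lower_bound equidistant_not_regular
  by meson

end
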